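(* The on-line algorithm SeparateClass is $\Theta(\log n)$ competitive on the linear array with $n$ nodes. That is, for every request sequence the number of wavelengths used by SeparateClass is $O(\log n)$ times the number used by an optimal off-line algorithm on that sequence, and there are request sequences for which SeparateClass uses $\Omega(\log n)$ times as many wavelengths as an optimal off-line algorithm.
   Context: On-line light-trail scheduling. The network is a linear array of nodes $0,1,\dots,n-1$; link $l$ joins nodes $l$ and $l+1$. A request sequence is a sequence of events, each being the arrival of a transmission $[s,d]$ ($0\le s<d\le n-1$) with bandwidth requirement in $(0,1]$, or the departure of a previously scheduled transmission, which releases its bandwidth. On each wavelength, shutters (ON/OFF) at the nodes divide the array into light-trails, which are the segments $[u,v]$ between consecutive OFF shutters (the shutters at the two end nodes are always OFF). An arriving transmission $[s,d]$ must be assigned to a light-trail $[u,v]$ with $u\le s<d\le v$; at any time the total bandwidth of the active transmissions assigned to a light-trail is at most $1$. Transmissions are not moved once assigned, and a light-trail is not modified while it carries active transmissions. In the splittable variation a transmission may be divided into several transmissions with the same endpoints whose bandwidths sum to the original one, assigned to possibly different light-trails; in the non-splittable variation this is not allowed. The statement is for both variations. An on-line algorithm makes assignments without knowing later events; an off-line algorithm is given the whole sequence at the beginning. The number of wavelengths used by an algorithm on a sequence is the maximum over time of the number of wavelengths in use; an optimal off-line algorithm minimizes this number. Classes, trail-points and phases. A transmission belongs to class $i$ if its length $d-s$ satisfies $2^{i-1}<d-s\le 2^i$. Only classes $i\ge 2$ are considered. A transmission crosses a node $u$ if $s<u<d$. The anchor of a class-$i$ transmission is the smallest-numbered node that it crosses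 and whose number is a multiple of $2^{i-1}$; its trail-point is the rightmost node numbered with a multiple of $2^{i-1}$ to the left of its anchor; if the trail-point is $q2^{i-1}$, the phase is $q\bmod 4$. A class-$i$ transmission with trail-point $x$ is allocated to a light-trail $[x,x+2^{i+1}]$ (cut off at the end of the array). Algorithm SeparateClass. Every allocated wavelength is assigned a class label $i$ and a phase label $p$ and has shutters OFF at the nodes $(4q+p)2^{i-1}$ for all $q$, so that it is configured to serve only transmissions of class $i$ and phase $p$. A transmission $t$ of class $i$ and phase $p$ is served only by a wavelength with the same labels. If there is such a wavelength $w$ on which the light-trail $L$ starting at the trail-point of $t$ has space, then $t$ is assigned to $L$ (no order of search among candidate wavelengths is specified). If no such wavelength is found, a new wavelength $w'$ is allocated, labelled and configured for class $i$ and phase $p$, and $t$ is assigned to the light-trail on $w'$ that starts at the trail-point of $t$. When a transmission finishes it is removed from its light-trail; when all transmissions on a wavelength have finished, its labels are removed and it can subsequently be used for other classes or phases.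
   Formalization: In the non-splittable variation the upper bound is stated for SeparateClass searching its labelled wavelengths in order of allocation (first fit); with an arbitrary search order the O(log n) bound fails, already for n = 4. *)

theory Defs
  imports Complex_Main
begin

section \<open>Requests and allocations\<close>

datatype variation = Splittable | NonSplittable

text \<open>
  A transmission is identified by the position of its \<open>Arrive\<close> event in the request sequence;
  \<open>Arrive s d b\<close> requests \<open>[s,d]\<close> with bandwidth \<open>b\<close>, and \<open>Depart j\<close> ends the transmission that
  arrived at position \<open>j\<close>.
\<close>

datatype event = Arrive nat nat real | Depart nat

text \<open>
  \<open>2 ^ i < 2 * (d - s)\<close> stands for \<open>2 ^ (i - 1) < d - s\<close>, so that the formula is also right for
  \<open>i = 0\<close>. For \<open>s < d\<close> there is exactly one such \<open>i\<close>.
\<close>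

definition tr_class :: "nat \<Rightarrow> nat \<Rightarrow> nat" where
  "tr_class s d = (THE i. 2 ^ i < 2 * (d - s) \<and> d - s \<le> 2 ^ i)"

definition crosses :: "nat \<Rightarrow> nat \<Rightarrow> nat \<Rightarrow> bool" where
  "crosses s d u \<longleftrightarrow> s < u \<and> u < d"

definition anchor :: "nat \<Rightarrow> nat \<Rightarrow> nat" where
  "anchor s d = (LEAST u. crosses s d u \<and> 2 ^ (tr_class s d - 1) dvd u)"

definition trail_point :: "nat \<Rightarrow> nat \<Rightarrow> nat" where
  "trail_point s d = (GREATEST x. x < anchor s d \<and> 2 ^ (tr_class s d - 1) dvd x)"

definition phase :: "nat \<Rightarrow> nat \<Rightarrow> nat" where
  "phase s d = (trail_point s d div 2 ^ (tr_class s d - 1)) mod 4"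

definition requests :: "nat \<Rightarrow> event list \<Rightarrow> bool" where
  "requests n es \<longleftrightarrow> (\<forall>t<length es. case es ! t of
      Arrive s d b \<Rightarrow> s < d \<and> d \<le> n - 1 \<and> 0 < b \<and> b \<le> 1 \<and> 2 \<le> tr_class s d
    | Depart j \<Rightarrow> j < t \<and> (\<exists>s d b. es ! j = Arrive s d b) \<and> Depart j \<notin> set (take t es))"

text \<open>
  A light-trail is a triple of a wavelength and its two end nodes. An allocation gives, for every
  transmission, the bandwidth that it currently occupies on every light-trail. In the splittable
  variation parts of one transmission that share a light-trail are merged.
\<close>

type_synonym trail = "nat \<times> nat \<times> nat"
type_synonym allocation = "nat \<Rightarrow> trail \<Rightarrow> real"

definition light_trail :: "nat set \<Rightarrow> nat \<Rightarrow> nat \<Rightarrow> bool" where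
  "light_trail off u v \<longleftrightarrow> u \<in> off \<and> v \<in> off \<and> u < v \<and> (\<forall>k. u < k \<and> k < v \<longrightarrow> k \<notin> off)"

definition load :: "allocation \<Rightarrow> trail \<Rightarrow> real" where
  "load A L = (\<Sum>j | A j L \<noteq> 0. A j L)"

definition in_use :: "allocation \<Rightarrow> nat set" where
  "in_use A = {w. \<exists>j u v. A j (w, u, v) \<noteq> 0}"

definition wavelengths_used :: "(nat \<Rightarrow> allocation) \<Rightarrow> event list \<Rightarrow> nat" where
  "wavelengths_used A es = Max ((\<lambda>t. card (in_use (A t))) ` {..length es})"

section \<open>Off-line schedules\<close>

definition division :: "variation \<Rightarrow> real \<Rightarrow> (trail \<Rightarrow> real) \<Rightarrow> bool" where
  "division v b f \<longleftrightarrow>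
     finite {L. f L \<noteq> 0} \<and> (\<forall>L. 0 \<le> f L) \<and> (\<Sum>L | f L \<noteq> 0. f L) = b \<and>
     (v = NonSplittable \<longrightarrow> (\<exists>L. \<forall>L'. L' \<noteq> L \<longrightarrow> f L' = 0))"

text \<open>
  \<open>off t w\<close> is the set of OFF shutters of wavelength \<open>w\<close>, and \<open>A t\<close> the allocation, after the first
  \<open>t\<close> events. Shutters may be changed at every event; the third conjunct, required at every time,
  keeps a light-trail intact for as long as it carries something.
\<close>

definition schedule ::
    "variation \<Rightarrow> nat \<Rightarrow> event list \<Rightarrow> (nat \<Rightarrow> nat \<Rightarrow> nat set) \<Rightarrow> (nat \<Rightarrow> allocation) \<Rightarrow> bool" where
  "schedule v n es off A \<longleftrightarrow>
     A 0 = (\<lambda>_ _. 0) \<and>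
     (\<forall>t<length es. case es ! t of
        Arrive s d b \<Rightarrow> \<exists>f. division v b f \<and>
          (\<forall>w x y. f (w, x, y) \<noteq> 0 \<longrightarrow> x \<le> s \<and> d \<le> y) \<and> A (Suc t) = (A t)(t := f)
      | Depart j \<Rightarrow> A (Suc t) = (A t)(j := (\<lambda>_. 0))) \<and>
     (\<forall>t\<le>length es.
        (\<forall>w. {0, n - 1} \<subseteq> off t w \<and> off t w \<subseteq> {..<n}) \<and>
        (\<forall>j w x y. A t j (w, x, y) \<noteq> 0 \<longrightarrow> light_trail (off t w) x y) \<and>
        (\<forall>L. load (A t) L \<le> 1))"

definition opt :: "variation \<Rightarrow> nat \<Rightarrow> event list \<Rightarrow> nat" where
  "opt v n es = (LEAST k. \<exists>off A. schedule v n es off A \<and> wavelengths_used A es = k)"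

section \<open>SeparateClass\<close>

definition sc_shutters :: "nat \<Rightarrow> nat \<Rightarrow> nat \<Rightarrow> nat set" where
  "sc_shutters n i p = {0, n - 1} \<union> {u. u < n \<and> (\<exists>q. u = (4 * q + p) * 2 ^ (i - 1))}"

text \<open>The end nodes of the light-trail that serves \<open>[s,d]\<close>.\<close>

definition sc_trail :: "nat \<Rightarrow> nat \<Rightarrow> nat \<Rightarrow> nat \<times> nat" where
  "sc_trail n s d = (trail_point s d,
     THE y. light_trail (sc_shutters n (tr_class s d) (phase s d)) (trail_point s d) y)"

text \<open>
  The wavelengths that carry labels, in the order in which they were allocated, each with its
  class and phase; and the current allocation.
\<close>

type_synonym sc_state = "(nat \<times> nat \<times> nat) list \<times> allocation"

text \<open>
  A light-trail with load \<open>a\<close> has space for a transmission of bandwidth \<open>r\<close> if the transmission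
  fits as a whole, or, if it may be split, if any bandwidth is left.
\<close>

definition has_space :: "variation \<Rightarrow> real \<Rightarrow> real \<Rightarrow> bool" where
  "has_space v a r = (case v of Splittable \<Rightarrow> a < 1 | NonSplittable \<Rightarrow> a + r \<le> 1)"

definition candidates ::
    "variation \<Rightarrow> nat \<Rightarrow> nat \<Rightarrow> nat \<Rightarrow> real \<Rightarrow> sc_state \<Rightarrow> nat list" where
  "candidates v n s d r st =
     map fst (filter (\<lambda>(w, i, p). i = tr_class s d \<and> p = phase s d \<and>
                        has_space v (load (snd st) (w, sc_trail n s d)) r) (fst st))"

text \<open>
  With \<open>Any_Order\<close> every candidate may be chosen, differently at each choice, so that it covers every
  way to search; with \<open>Allocation_Order\<close> the candidates are searched from the earliest allocated
  one on (first fit). The distinction matters: without splitting, \<open>Any_Order\<close> has no bounded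
  competitive ratio, since transmissions of bandwidth \<open>1 - e k\<close> and \<open>e k\<close>, with \<open>e k\<close> decreasing and
  the large one leaving at once, can leave one small transmission on each of arbitrarily many
  wavelengths, where two wavelengths would do.
\<close>

datatype search = Any_Order | Allocation_Order

fun chosen :: "search \<Rightarrow> nat list \<Rightarrow> nat \<Rightarrow> bool" where
  "chosen Any_Order ws w \<longleftrightarrow> w \<in> set ws"
| "chosen Allocation_Order ws w \<longleftrightarrow> ws \<noteq> [] \<and> w = hd ws"

definition assign :: "allocation \<Rightarrow> nat \<Rightarrow> trail \<Rightarrow> real \<Rightarrow> allocation" where
  "assign A j L a = A(j := (A j)(L := a))"

text \<open>
  \<open>sc_serve v ord n j s d r st st'\<close>: from state \<open>st\<close>, serving what remains of transmission \<open>j\<close>, a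
  \<open>[s,d]\<close> of remaining bandwidth \<open>r\<close>, can end in state \<open>st'\<close>. In the non-splittable variation the
  minimum in rule \<open>found\<close> is \<open>r\<close>, so the transmission is placed in one piece.
\<close>

inductive sc_serve ::
    "variation \<Rightarrow> search \<Rightarrow> nat \<Rightarrow> nat \<Rightarrow> nat \<Rightarrow> nat \<Rightarrow> real \<Rightarrow> sc_state \<Rightarrow> sc_state \<Rightarrow> bool"
  for v ord n j s d where
  served: "sc_serve v ord n j s d 0 st st"
| found: "\<lbrakk>0 < r; chosen ord (candidates v n s d r (ls, A)) w; L = (w, sc_trail n s d);
           a = min r (1 - load A L);
           sc_serve v ord n j s d (r - a) (ls, assign A j L a) st'\<rbrakk>
          \<Longrightarrow> sc_serve v ord n j s d r (ls, A) st'"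
| fresh: "\<lbrakk>0 < r; candidates v n s d r (ls, A) = []; w \<notin> fst ` set ls\<rbrakk>
          \<Longrightarrow> sc_serve v ord n j s d r (ls, A)
                (ls @ [(w, tr_class s d, phase s d)], assign A j (w, sc_trail n s d) r)"

fun sc_step :: "variation \<Rightarrow> search \<Rightarrow> nat \<Rightarrow> nat \<Rightarrow> event \<Rightarrow> sc_state \<Rightarrow> sc_state \<Rightarrow> bool" where
  "sc_step v ord n t (Arrive s d b) st st' \<longleftrightarrow> sc_serve v ord n t s d b st st'"
| "sc_step v ord n t (Depart j) (ls, A) st' \<longleftrightarrow>
     (let A' = A(j := (\<lambda>_. 0)) in st' = (filter (\<lambda>(w, _). w \<in> in_use A') ls, A'))"

definition sc_run ::
    "variation \<Rightarrow> search \<Rightarrow> nat \<Rightarrow> event list \<Rightarrow> (nat \<Rightarrow> sc_state) \<Rightarrow> bool" where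
  "sc_run v ord n es S \<longleftrightarrow> S 0 = ([], \<lambda>_ _. 0) \<and>
     (\<forall>t<length es. sc_step v ord n t (es ! t) (S t) (S (Suc t)))"

definition sc_uses :: "variation \<Rightarrow> search \<Rightarrow> nat \<Rightarrow> event list \<Rightarrow> nat \<Rightarrow> bool" where
  "sc_uses v ord n es k \<longleftrightarrow>
     (\<exists>S. sc_run v ord n es S \<and> k = wavelengths_used (\<lambda>t. snd (S t)) es)"

end

theory Submission
  imports Defs
begin

text \<open>
  All transmissions with the same class and trail-point use the link to the left of their common
  anchor, and the bandwidth active on a link is at most \<open>opt\<close>. There are at most \<open>4 log n\<close> pairs of a
  class and a phase, so it suffices to bound the number of wavelengths of one pair by \<open>3 opt\<close> each
  time a new one is allocated. At that time no trail of the pair at the trail-point in question has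
  space. With splitting these trails are full, so their number is less than \<open>opt\<close>. Without splitting,
  if the new transmission has bandwidth at most 1/2, they are more than half full, so their number
  is less than \<open>2 opt\<close>. Otherwise, fewer than \<open>opt\<close> of them hold a transmission of bandwidth above
  1/2, since two such transmissions cannot share a trail off-line either; and the last one of the
  others holds a transmission for which, when it was placed, first fit found all its predecessors
  more than half full, so that it has fewer than \<open>2 opt\<close> of them.
\<close>

section \<open>Active bandwidth\<close>

text \<open>Read off the request sequence alone, so that an off-line schedule and SeparateClass can
  be compared through it. A transmission that has not arrived yet or has departed counts as 0, so
  sums need not single out the active ones.\<close>

definition bw :: "event list \<Rightarrow> nat \<Rightarrow> nat \<Rightarrow> real" where
  "bw es t j = (if j < t \<and> Depart j \<notin> set (take t es)
     then case es ! j of Arrive s d b \<Rightarrow> b | Depart _ \<Rightarrow> 0 else 0)"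

lemma requests_Arrive:
  assumes "requests n es" "t < length es" "es ! t = Arrive s d b"
  shows "s < d" "d \<le> n - 1" "0 < b" "b \<le> 1" "2 \<le> tr_class s d"
  using assms(1)[unfolded requests_def, rule_format, OF assms(2)] assms(3) by simp_all

lemma requests_Depart:
  assumes "requests n es" "t < length es" "es ! t = Depart j"
  shows "j < t"
  using assms(1)[unfolded requests_def, rule_format, OF assms(2)] assms(3) by simp

lemma bw_0 [simp]: "bw es 0 = (\<lambda>_. 0)"
  by (simp add: bw_def fun_eq_iff)

text \<open>A departure names an earlier position, so \<open>Depart j\<close> can stand only after
  position \<open>j\<close>. Hence a transmission that has just arrived is active.\<close>

lemma Depart_notin_take:
  assumes "requests n es" "t \<le> length es" "t \<le> Suc j"
  shows "Depart j \<notin> set (take t es)"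
proof
  assume "Depart j \<in> set (take t es)"
  then obtain k where "k < t" "k < length es" "es ! k = Depart j"
    by (auto simp: in_set_conv_nth)
  with requests_Depart[OF assms(1), of k j] assms(3) show False by simp
qed

lemma bw_Arrive:
  assumes "requests n es" "t < length es" "es ! t = Arrive s d b"
  shows "bw es (Suc t) = (bw es t)(t := b)"
proof
  fix j
  show "bw es (Suc t) j = ((bw es t)(t := b)) j"
    using Depart_notin_take[OF assms(1), of "Suc t" t] assms
    by (auto simp: bw_def take_Suc_conv_app_nth)
qed

lemma bw_Depart:
  assumes "requests n es" "t < length es" "es ! t = Depart j"
  shows "bw es (Suc t) = (bw es t)(j := 0)"
proof
  fix i
  show "bw es (Suc t) i = ((bw es t)(j := 0)) i"
    using assms by (cases "i = t") (auto simp: bw_def take_Suc_conv_app_nth less_Suc_eq)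
qed

lemma bw_nonneg:
  assumes "requests n es" "t \<le> length es"
  shows "0 \<le> bw es t j"
proof (cases "j < t \<and> (\<exists>s d b. es ! j = Arrive s d b)")
  case True
  then obtain s d b where "j < t" "es ! j = Arrive s d b" by blast
  with requests_Arrive(3)[OF assms(1), of j s d b] assms(2) show ?thesis by (simp add: bw_def)
next
  case False
  then show ?thesis by (cases "es ! j") (simp_all add: bw_def)
qed

section \<open>Off-line schedules\<close>

text \<open>\<open>load\<close> sums over a support that varies with the light-trail. A fixed finite
  index set is what makes it possible to interchange sums over transmissions and trails.\<close>

lemma load_eq_sum:
  assumes "finite F" "{j. A j L \<noteq> 0} \<subseteq> F"
  shows "load A L = (\<Sum>j\<in>F. A j L)"
  unfolding load_def using assms by (intro sum.mono_neutral_left) auto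

lemma divisionD:
  assumes "division v b f"
  shows "finite {L. f L \<noteq> 0}" "0 \<le> f L" "(\<Sum>L | f L \<noteq> 0. f L) = b"
    "v = NonSplittable \<Longrightarrow> \<exists>L. \<forall>L'. L' \<noteq> L \<longrightarrow> f L' = 0"
  using assms unfolding division_def by blast+

lemma division_zero: "division v 0 (\<lambda>_. 0)"
  by (simp add: division_def)

lemma division_sum_eq:
  assumes "division v b f" "finite T" "{L. f L \<noteq> 0} \<subseteq> T"
  shows "(\<Sum>L\<in>T. f L) = b"
proof -
  have "(\<Sum>L | f L \<noteq> 0. f L) = (\<Sum>L\<in>T. f L)"
    using assms(2,3) by (intro sum.mono_neutral_left) auto
  with divisionD(3)[OF assms(1)] show ?thesis by simp
qed

lemma division_sum_le:
  assumes "division v b f" "finite T"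
  shows "(\<Sum>L\<in>T. f L) \<le> b"
proof -
  let ?U = "T \<union> {L. f L \<noteq> 0}"
  have fin: "finite ?U" using assms(2) divisionD(1)[OF assms(1)] by simp
  have "(\<Sum>L\<in>T. f L) \<le> (\<Sum>L\<in>?U. f L)"
    using fin divisionD(2)[OF assms(1)] by (intro sum_mono2) auto
  also have "\<dots> = b" by (rule division_sum_eq[OF assms(1) fin]) auto
  finally show ?thesis .
qed

lemma division_pos:
  assumes "division v b f" "0 < b"
  obtains L where "f L \<noteq> 0"
proof -
  have "{L. f L \<noteq> 0} \<noteq> {}" using divisionD(3)[OF assms(1)] assms(2) by force
  with that show ?thesis by blast
qed

lemma division_NonSplittable:
  assumes "division NonSplittable b f" "f L \<noteq> 0"
  shows "f = (\<lambda>_. 0)(L := b)"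
proof -
  obtain L0 where "\<And>L'. L' \<noteq> L0 \<Longrightarrow> f L' = 0"
    using divisionD(4)[OF assms(1)] by blast
  with assms(2) have z: "f L' = 0" if "L' \<noteq> L" for L' using that by metis
  then have "{L. f L \<noteq> 0} \<subseteq> {L}" by auto
  from division_sum_eq[OF assms(1) _ this] have "f L = b" by simp
  with z show ?thesis by auto
qed

lemma division_single:
  assumes "0 \<le> b"
  shows "division v b ((\<lambda>_. 0)(L := b))"
proof -
  let ?f = "(\<lambda>_. 0)(L := b)"
  have "{L'. ?f L' \<noteq> 0} = (if b = 0 then {} else {L})" by auto
  moreover have "\<exists>L. \<forall>L'. L' \<noteq> L \<longrightarrow> ?f L' = 0" by (rule exI[of _ L]) simp
  ultimately show ?thesis using assms unfolding division_def by simp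
qed

text \<open>The light-trails of a wavelength do not overlap in a link \<open>l\<close>: otherwise an
  end of one would lie strictly inside the other, where no shutter is OFF.\<close>

lemma light_trail_unique:
  assumes "light_trail off x y" "light_trail off x' y'" "x \<le> l" "l < y" "x' \<le> l" "l < y'"
  shows "x = x' \<and> y = y'"
proof -
  have 1: "x' \<le> x \<and> y \<le> y'"
    if "light_trail off x y" "light_trail off x' y'" "x' \<le> l" "l < y" "x \<le> l" "l < y'" for x y x' y'
  proof -
    have "x' \<in> off" "y' \<in> off" and free: "\<And>k. x < k \<Longrightarrow> k < y \<Longrightarrow> k \<notin> off"
      using that(1,2) unfolding light_trail_def by blast+
    then have "\<not> (x < x' \<and> x' < y)" "\<not> (x < y' \<and> y' < y)" by blast+
    with that(3-) show ?thesis by simp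
  qed
  from 1[OF assms(1,2,5,4,3,6)] 1[OF assms(2,1,3,6,5,4)] show ?thesis by simp
qed

text \<open>An arrival installs a division of its bandwidth, a departure resets its row to 0, and no
  event touches another row; \<open>bw\<close> changes in the same way.\<close>

lemma schedule_alloc:
  assumes S: "schedule v n es off A" and R: "requests n es" and "t \<le> length es"
  shows "division v (bw es t j) (A t j) \<and>
    (\<forall>w x y. A t j (w, x, y) \<noteq> 0 \<longrightarrow> j < t \<and> (\<exists>s d b. es ! j = Arrive s d b \<and> x \<le> s \<and> d \<le> y))"
  using \<open>t \<le> length es\<close>
proof (induction t arbitrary: j)
  case 0
  have "A 0 = (\<lambda>_ _. 0)" using S unfolding schedule_def by blast
  then show ?case by (simp add: division_zero)
next
  case (Suc t)
  then have t: "t < length es" by simp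
  have step: "case es ! t of
        Arrive s d b \<Rightarrow> \<exists>f. division v b f \<and>
          (\<forall>w x y. f (w, x, y) \<noteq> 0 \<longrightarrow> x \<le> s \<and> d \<le> y) \<and> A (Suc t) = (A t)(t := f)
      | Depart j \<Rightarrow> A (Suc t) = (A t)(j := (\<lambda>_. 0))"
    using S t unfolding schedule_def by blast
  note IH0 = Suc.IH[OF less_imp_le[OF t], of j]
  have arrived: "j < Suc t \<and> (\<exists>s d b. es ! j = Arrive s d b \<and> x \<le> s \<and> d \<le> y)"
    if "A t j (w, x, y) \<noteq> 0" for w x y
    using IH0[THEN conjunct2, rule_format, OF that] less_SucI by simp
  note IH = IH0[THEN conjunct1] arrived
  show ?case
  proof (cases "es ! t")
    case (Arrive s d b)
    with step obtain f where f: "division v b f"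
      "\<forall>w x y. f (w, x, y) \<noteq> 0 \<longrightarrow> x \<le> s \<and> d \<le> y" "A (Suc t) = (A t)(t := f)"
      by auto
    show ?thesis
    proof (cases "j = t")
      case True
      with f bw_Arrive[OF R t Arrive] Arrive show ?thesis by simp
    next
      case False
      with IH f(3) bw_Arrive[OF R t Arrive] show ?thesis by simp
    qed
  next
    case (Depart i)
    with step have A: "A (Suc t) = (A t)(i := (\<lambda>_. 0))" by simp
    show ?thesis
    proof (cases "j = i")
      case True
      with A bw_Depart[OF R t Depart] show ?thesis by (simp add: division_zero)
    next
      case False
      with IH A bw_Depart[OF R t Depart] show ?thesis by simp
    qed
  qed
qed

lemmas schedule_division = schedule_alloc[THEN conjunct1]

lemma schedule_arrived:
  assumes "schedule v n es off A" "requests n es" "t \<le> length es" "A t j L \<noteq> 0"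
  shows "j < t"
  using schedule_alloc[OF assms(1-3), of j] assms(4) by (cases L) blast

section \<open>Bounds from the transmissions over one link\<close>

text \<open>Taken over the whole sequence rather than at one time, since \<open>bw\<close> already
  discards what is inactive.\<close>

definition link_users :: "event list \<Rightarrow> nat \<Rightarrow> nat set" where
  "link_users es l = {j. j < length es \<and> (\<exists>s d b. es ! j = Arrive s d b \<and> s \<le> l \<and> l < d)}"

lemma finite_link_users: "J \<subseteq> link_users es l \<Longrightarrow> finite J"
  by (rule finite_subset[of _ "{..<length es}"]) (auto simp: link_users_def)

lemma schedule_trail:
  assumes "schedule v n es off A" "requests n es" "t \<le> length es"
    and "A t j (w, x, y) \<noteq> 0" "j \<in> link_users es l"
  shows "light_trail (off t w) x y" "x \<le> l" "l < y"
proof -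
  show "light_trail (off t w) x y"
    using assms unfolding schedule_def by blast
  show "x \<le> l" "l < y"
    using schedule_alloc[OF assms(1-3), of j, THEN conjunct2, rule_format, OF assms(4)] assms(5)
    by (auto simp: link_users_def)
qed

lemma schedule_trail_unique:
  assumes "schedule v n es off A" "requests n es" "t \<le> length es"
    and "A t j (w, x, y) \<noteq> 0" "j \<in> link_users es l"
    and "A t j' (w, x', y') \<noteq> 0" "j' \<in> link_users es l"
  shows "x = x' \<and> y = y'"
  using schedule_trail[OF assms(1-5)] schedule_trail[OF assms(1-3,6,7)]
  by (intro light_trail_unique[of "off t w" x y x' y' l])

lemma finite_in_use:
  assumes "\<And>j L. A j L \<noteq> 0 \<Longrightarrow> j < m" "\<And>j. finite {L. A j L \<noteq> 0}"
  shows "finite (in_use A)"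
proof -
  have "in_use A \<subseteq> fst ` (\<Union>j<m. {L. A j L \<noteq> 0})"
  proof
    fix w assume "w \<in> in_use A"
    then obtain j u v where nz: "A j (w, u, v) \<noteq> 0" unfolding in_use_def by blast
    with assms(1)[OF nz] show "w \<in> fst ` (\<Union>j<m. {L. A j L \<noteq> 0})"
      by (intro image_eqI[of _ _ "(w, u, v)"]) auto
  qed
  then show ?thesis by (rule finite_subset) (use assms(2) in simp)
qed

lemma schedule_finite_in_use:
  assumes "schedule v n es off A" "requests n es" "t \<le> length es"
  shows "finite (in_use (A t))"
  using schedule_arrived[OF assms] divisionD(1)[OF schedule_division[OF assms]]
  by (rule finite_in_use)

lemma schedule_load:
  assumes "schedule v n es off A" "requests n es" "t \<le> length es" "finite J"
  shows "(\<Sum>j\<in>J. A t j L) \<le> 1"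
proof -
  have sub: "{j. A t j L \<noteq> 0} \<subseteq> {..<t}"
    using schedule_arrived[OF assms(1-3)] by blast
  have "(\<Sum>j\<in>J. A t j L) \<le> (\<Sum>j\<in>J \<union> {..<t}. A t j L)"
    using assms(4) divisionD(2)[OF schedule_division[OF assms(1-3)]]
    by (intro sum_mono2) auto
  also have "\<dots> = load (A t) L"
    using sub assms(4) by (intro load_eq_sum[symmetric]) auto
  also have "\<dots> \<le> 1" using assms unfolding schedule_def by blast
  finally show ?thesis .
qed

text \<open>On each wavelength only one light-trail contains the link \<open>l\<close>, and it
  carries at most 1. Counting the bandwidth of \<open>J\<close> by light-trails instead of by
  transmissions therefore gives at most one unit per wavelength.\<close>

lemma schedule_congestion:
  assumes S: "schedule v n es off A" "requests n es" "t \<le> length es"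
    and J: "J \<subseteq> link_users es l"
  shows "(\<Sum>j\<in>J. bw es t j) \<le> card (in_use (A t))"
proof -
  note D = schedule_division[OF S]
  let ?T = "\<Union>j\<in>J. {L. A t j L \<noteq> 0}"
  have fJ: "finite J" using J by (rule finite_link_users)
  have fT: "finite ?T" using fJ divisionD(1)[OF D] by blast
  \<comment> \<open>All trails in \<open>?T\<close> contain the link \<open>l\<close>, so the
    wavelength determines the trail.\<close>
  have inj: "inj_on fst ?T"
  proof (rule inj_onI, goal_cases)
    case (1 L L')
    then obtain w x y x' y' j j' where "L = (w, x, y)" "L' = (w, x', y')"
      "j \<in> J" "A t j (w, x, y) \<noteq> 0" "j' \<in> J" "A t j' (w, x', y') \<noteq> 0"
      by (cases L, cases L') auto
    with schedule_trail_unique[OF S, of j w x y l j' x' y'] J show ?case by auto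
  qed
  have "(\<Sum>j\<in>J. bw es t j) = (\<Sum>j\<in>J. \<Sum>L\<in>?T. A t j L)"
    using fT by (intro sum.cong refl division_sum_eq[OF D, symmetric]) auto
  also have "\<dots> = (\<Sum>L\<in>?T. \<Sum>j\<in>J. A t j L)" by (rule sum.swap)
  also have "\<dots> \<le> (\<Sum>L\<in>?T. 1)" by (intro sum_mono schedule_load[OF S fJ])
  also have "\<dots> = card (fst ` ?T)" using inj by (simp add: card_image)
  also have "\<dots> \<le> card (in_use (A t))"
  proof (intro of_nat_mono card_mono schedule_finite_in_use[OF S] subsetI)
    fix w assume "w \<in> fst ` ?T"
    then show "w \<in> in_use (A t)" unfolding in_use_def by force
  qed
  finally show ?thesis .
qed

text \<open>Each of these transmissions sits whole on one trail. Two of them on one wavelength would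
  share the trail through the link \<open>l\<close> and overload it, so their wavelengths are
  distinct.\<close>

lemma schedule_big:
  assumes S: "schedule NonSplittable n es off A" "requests n es" "t \<le> length es"
    and J: "J \<subseteq> link_users es l" and big: "\<And>j. j \<in> J \<Longrightarrow> 1 / 2 < bw es t j"
  shows "card J \<le> card (in_use (A t))"
proof -
  note D = schedule_division[OF S]
  have "\<exists>L. A t j L = bw es t j" if "j \<in> J" for j
  proof -
    have "division NonSplittable (bw es t j) (A t j)" "0 < bw es t j"
      using D big[OF that] by auto
    then show ?thesis by (metis division_pos division_NonSplittable fun_upd_same)
  qed
  then obtain L where L: "\<And>j. j \<in> J \<Longrightarrow> A t j (L j) = bw es t j" by metis
  then have nz: "A t j (L j) \<noteq> 0" if "j \<in> J" for j using big[OF that] that by force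
  have "inj_on (fst \<circ> L) J"
  proof (rule inj_onI, rule ccontr)
    fix j j' assume j: "j \<in> J" "j' \<in> J" "(fst \<circ> L) j = (fst \<circ> L) j'" and ne: "j \<noteq> j'"
    obtain w x y where 1: "L j = (w, x, y)" by (cases "L j")
    with j obtain x' y' where 2: "L j' = (w, x', y')" by (cases "L j'") auto
    have eq: "L j = L j'"
      using schedule_trail_unique[OF S, of j w x y l j' x' y'] nz[OF j(1)] nz[OF j(2)]
        subsetD[OF J j(1)] subsetD[OF J j(2)] unfolding 1 2 by blast
    have "(\<Sum>i\<in>{j, j'}. A t i (L j)) \<le> 1" by (rule schedule_load[OF S]) simp
    then have "bw es t j + bw es t j' \<le> 1" using ne L[OF j(1)] L[OF j(2)] eq by simp
    with big[OF j(1)] big[OF j(2)] show False by simp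
  qed
  then have "card J = card ((fst \<circ> L) ` J)" by (rule card_image[symmetric])
  also have "\<dots> \<le> card (in_use (A t))"
  proof (rule card_mono[OF schedule_finite_in_use[OF S]], safe)
    fix j assume "j \<in> J"
    from nz[OF this] show "(fst \<circ> L) j \<in> in_use (A t)"
      by (cases "L j") (auto simp: in_use_def)
  qed
  finally show ?thesis .
qed

section \<open>Construction of schedules and attainment of the optimum\<close>

text \<open>With only the end shutters OFF, every wavelength is a single light-trail that covers all
  requests, so only its capacity matters. Used with the identity for \<open>\<sigma>\<close>, to see
  that some schedule exists, and with the constant 0, for the lower bound.\<close>

lemma schedule_exists:
  fixes \<sigma> :: "nat \<Rightarrow> nat"
  assumes n: "2 \<le> n" and R: "requests n es"
    and cap: "\<And>t w. t \<le> length es \<Longrightarrow> (\<Sum>j | j < t \<and> \<sigma> j = w. bw es t j) \<le> 1"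
  defines "A \<equiv> \<lambda>t j. (\<lambda>_. 0)((\<sigma> j, 0, n - 1) := bw es t j)"
  shows "schedule v n es (\<lambda>_ _. {0, n - 1}) A"
  unfolding schedule_def
proof (intro conjI allI impI)
  show "A 0 = (\<lambda>_ _. 0)" by (auto simp: A_def)
next
  fix t assume t: "t < length es"
  show "case es ! t of
        Arrive s d b \<Rightarrow> \<exists>f. division v b f \<and>
          (\<forall>w x y. f (w, x, y) \<noteq> 0 \<longrightarrow> x \<le> s \<and> d \<le> y) \<and> A (Suc t) = (A t)(t := f)
      | Depart j \<Rightarrow> A (Suc t) = (A t)(j := (\<lambda>_. 0))"
  proof (cases "es ! t")
    case (Arrive s d b)
    have "division v b ((\<lambda>_. 0)((\<sigma> t, 0, n - 1) := b))"
      using requests_Arrive(3)[OF R t Arrive] by (intro division_single) simp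
    moreover have "A (Suc t) = (A t)(t := (\<lambda>_. 0)((\<sigma> t, 0, n - 1) := b))"
      by (auto simp: A_def bw_Arrive[OF R t Arrive])
    moreover have "x \<le> s \<and> d \<le> y" if "((\<lambda>_. 0)((\<sigma> t, 0, n - 1) := b)) (w, x, y) \<noteq> 0" for w x y
      using that requests_Arrive(2)[OF R t Arrive] by (simp split: if_splits)
    ultimately show ?thesis using Arrive by (simp only: event.case) blast
  next
    case (Depart j)
    then show ?thesis by (auto simp: A_def bw_Depart[OF R t Depart])
  qed
next
  fix t L assume t: "t \<le> length es"
  show "load (A t) L \<le> 1"
  proof -
    obtain w x y where L: "L = (w, x, y)" by (cases L)
    have nz: "{j. A t j L \<noteq> 0} \<subseteq> {j. j < t \<and> \<sigma> j = w}"
      by (auto simp: A_def L bw_def split: if_splits)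
    have "load (A t) L = (\<Sum>j | j < t \<and> \<sigma> j = w. A t j L)"
      using nz by (intro load_eq_sum) simp_all
    also have "\<dots> \<le> (\<Sum>j | j < t \<and> \<sigma> j = w. bw es t j)"
      using bw_nonneg[OF R t] by (intro sum_mono) (auto simp: A_def)
    finally show ?thesis using cap[OF t, of w] by simp
  qed
next
  fix t w j x y assume "A t j (w, x, y) \<noteq> 0"
  then show "light_trail {0, n - 1} x y"
    using n by (auto simp: A_def light_trail_def split: if_splits)
qed (use n in auto)

lemma card_le_wavelengths_used:
  "t \<le> length es \<Longrightarrow> card (in_use (A t)) \<le> wavelengths_used A es"
  unfolding wavelengths_used_def by (intro Max_ge) auto

lemma wavelengths_used_le:
  assumes "\<And>t. t \<le> length es \<Longrightarrow> card (in_use (A t)) \<le> k"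
  shows "wavelengths_used A es \<le> k"
  unfolding wavelengths_used_def using assms by (subst Max_le_iff) auto

lemma opt_attained:
  assumes "2 \<le> n" "requests n es"
  obtains off A where "schedule v n es off A"
    "\<And>t. t \<le> length es \<Longrightarrow> card (in_use (A t)) \<le> opt v n es"
proof -
  \<comment> \<open>A private wavelength for every transmission is a valid schedule, which makes the
    \<open>LEAST\<close> in \<open>opt\<close> meaningful.\<close>
  have "(\<Sum>j | j < t \<and> j = w. bw es t j) \<le> 1" if "t \<le> length es" for t w
  proof -
    have "{j. j < t \<and> j = w} = (if w < t then {w} else {})" by auto
    moreover have "bw es t w \<le> 1" if "w < t"
      using that \<open>t \<le> length es\<close> requests_Arrive(4)[OF assms(2), of w]
      by (auto simp: bw_def split: event.splits)
    ultimately show ?thesis by auto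
  qed
  from schedule_exists[where \<sigma> = "\<lambda>j. j", OF assms this]
  have "\<exists>k off A. schedule v n es off A \<and> wavelengths_used A es = k" by blast
  then have "\<exists>off A. schedule v n es off A \<and> wavelengths_used A es = opt v n es"
    unfolding opt_def by (rule LeastI_ex)
  with that show ?thesis by (metis card_le_wavelengths_used)
qed

lemma congestion_le_opt:
  assumes "2 \<le> n" "requests n es" "t \<le> length es" "J \<subseteq> link_users es l"
  shows "(\<Sum>j\<in>J. bw es t j) \<le> opt v n es"
proof -
  obtain off A where S: "schedule v n es off A"
    and *: "\<And>t. t \<le> length es \<Longrightarrow> card (in_use (A t)) \<le> opt v n es"
    by (rule opt_attained[OF assms(1,2)]) blast
  from schedule_congestion[OF S assms(2-4)] *[OF assms(3)] show ?thesis by linarith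
qed

lemma big_le_opt:
  assumes "2 \<le> n" "requests n es" "t \<le> length es" "J \<subseteq> link_users es l"
    and "\<And>j. j \<in> J \<Longrightarrow> 1 / 2 < bw es t j"
  shows "card J \<le> opt NonSplittable n es"
proof -
  obtain off A where S: "schedule NonSplittable n es off A"
    and *: "\<And>t. t \<le> length es \<Longrightarrow> card (in_use (A t)) \<le> opt NonSplittable n es"
    by (rule opt_attained[OF assms(1,2)]) blast
  from schedule_big[OF S assms(2-5)] *[OF assms(3)] show ?thesis by linarith
qed

section \<open>Classes and trail-points\<close>

text \<open>Two exponents \<open>i\<close> and \<open>k\<close> with these bounds satisfy
  \<open>2 ^ k < 2 * (d - s) \<le> 2 ^ Suc i\<close> and the same with \<open>i\<close> and
  \<open>k\<close> exchanged, hence they agree.\<close>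

lemma tr_class_eqI:
  assumes "2 ^ i < 2 * (d - s)" "d - s \<le> 2 ^ i"
  shows "tr_class s d = i"
  unfolding tr_class_def
proof (rule the_equality)
  fix k :: nat assume k: "2 ^ k < 2 * (d - s) \<and> d - s \<le> 2 ^ k"
  have "(2::nat) ^ k < 2 ^ Suc i" "(2::nat) ^ i < 2 ^ Suc k" using k assms by auto
  then have "k < Suc i" "i < Suc k" by (simp_all only: power_strict_increasing_iff)
  then show "k = i" by simp
qed (use assms in auto)

lemma tr_class_bounds:
  assumes "s < d"
  shows "2 ^ tr_class s d < 2 * (d - s)" "d - s \<le> 2 ^ tr_class s d"
proof -
  let ?i = "LEAST i. d - s \<le> 2 ^ i"
  have "d - s \<le> 2 ^ (d - s)" by simp
  then have 1: "d - s \<le> 2 ^ ?i" by (rule LeastI)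
  have 2: "2 ^ ?i < 2 * (d - s)"
  proof (cases ?i)
    case 0
    then show ?thesis using assms by simp
  next
    case (Suc k)
    then have "\<not> d - s \<le> 2 ^ k" using not_less_Least by (metis lessI)
    then show ?thesis using Suc by simp
  qed
  from tr_class_eqI[OF 2 1] 1 2 show "2 ^ tr_class s d < 2 * (d - s)" "d - s \<le> 2 ^ tr_class s d"
    by simp_all
qed

text \<open>The anchor lies exactly \<open>h\<close> to the right of the trail-point, and it is
  strictly inside the transmission. So the link just left of the anchor is used, and its number
  depends only on class and trail-point.\<close>

lemma anchor_link:
  assumes "s < d" "2 \<le> tr_class s d"
  defines "h \<equiv> 2 ^ (tr_class s d - 1)"
  shows "s \<le> trail_point s d + h - 1" "trail_point s d + h - 1 < d"
proof -
  let ?P = "\<lambda>u. crosses s d u \<and> h dvd u"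
  have h0: "0 < h" by (simp add: h_def)
  have "2 * h = 2 ^ tr_class s d" using assms(2) unfolding h_def
    by (metis One_nat_def Suc_diff_1 Suc_le_eq less_le_trans power_Suc zero_less_numeral)
  with tr_class_bounds(1)[OF assms(1)] have hd: "h < d - s" by simp
  \<comment> \<open>The anchor exists: the first multiple of \<open>h\<close> beyond
    \<open>s\<close> is at most \<open>s + h\<close>, which is less than \<open>d\<close>.\<close>
  have "s mod h < h" using h0 by simp
  moreover have "(s div h + 1) * h = s - s mod h + h" "s mod h \<le> s"
    by (simp_all add: minus_mod_eq_div_mult)
  ultimately have "crosses s d ((s div h + 1) * h)"
    using hd unfolding crosses_def by linarith
  then have "?P ((s div h + 1) * h)" by simp
  then have a: "?P (anchor s d)" unfolding anchor_def h_def by (rule LeastI)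
  then obtain q where q: "anchor s d = h * q" by blast
  have "0 < q" using a q by (auto simp: crosses_def intro: Suc_leI gr0I)
  then obtain q' where q': "q = Suc q'" by (cases q) auto
  have "trail_point s d = h * q'"
    unfolding trail_point_def
  proof (rule Greatest_equality)
    show "h * q' < anchor s d \<and> 2 ^ (tr_class s d - 1) dvd h * q'"
      using q q' h0 by (simp add: h_def)
  next
    fix y assume y: "y < anchor s d \<and> 2 ^ (tr_class s d - 1) dvd y"
    then obtain k where k: "y = h * k" by (auto simp: h_def)
    then have "k < q" using y q by simp
    then show "y \<le> h * q'" using k q' by simp
  qed
  then have "trail_point s d + h = anchor s d" using q q' by simp
  with a show "s \<le> trail_point s d + h - 1" "trail_point s d + h - 1 < d"
    by (auto simp: crosses_def)
qed

text \<open>The transmissions that compete for the same light-trails in SeparateClass, whether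
  active or not. By \<open>peers_link\<close> they all use a common link.\<close>

definition peers :: "event list \<Rightarrow> nat \<Rightarrow> nat \<Rightarrow> nat set" where
  "peers es s d = {j. j < length es \<and> (\<exists>s' d' b'. es ! j = Arrive s' d' b' \<and>
     tr_class s' d' = tr_class s d \<and> trail_point s' d' = trail_point s d)}"

lemma peers_link:
  assumes "requests n es"
  shows "peers es s d \<subseteq> link_users es (trail_point s d + 2 ^ (tr_class s d - 1) - 1)"
proof
  fix j assume "j \<in> peers es s d"
  then obtain s' d' b' where j: "j < length es" "es ! j = Arrive s' d' b'"
    and eq: "tr_class s' d' = tr_class s d" "trail_point s' d' = trail_point s d"
    by (auto simp: peers_def)
  from anchor_link[OF requests_Arrive(1,5)[OF assms j]] j eq
  show "j \<in> link_users es (trail_point s d + 2 ^ (tr_class s d - 1) - 1)"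
    by (auto simp: link_users_def)
qed

lemma finite_peers: "finite (peers es s d)"
  by (rule finite_subset[of _ "{..<length es}"]) (auto simp: peers_def)

section \<open>Serving a transmission\<close>

definition labelled :: "(nat \<times> nat \<times> nat) list \<Rightarrow> nat \<Rightarrow> nat \<Rightarrow> nat set" where
  "labelled ls i p = {w. (w, i, p) \<in> set ls}"

lemma finite_labelled [simp]: "finite (labelled ls i p)"
proof (rule finite_subset)
  show "labelled ls i p \<subseteq> fst ` set ls" unfolding labelled_def by force
qed simp

lemma mem_candidates:
  "w \<in> set (candidates v n s d r (ls, A)) \<longleftrightarrow>
     w \<in> labelled ls (tr_class s d) (phase s d) \<and> has_space v (load A (w, sc_trail n s d)) r"
  unfolding candidates_def labelled_def by force

lemma chosen_in_set: "chosen ord ws w \<Longrightarrow> w \<in> set ws"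
  by (cases ord) auto

lemma chosen_hd: "ws \<noteq> [] \<Longrightarrow> chosen ord ws (hd ws)"
  by (cases ord) auto

text \<open>\<open>\<beta> j\<close> is the bandwidth of transmission \<open>j\<close> that has been placed so far.\<close>

definition consistent ::
    "variation \<Rightarrow> nat \<Rightarrow> event list \<Rightarrow> (nat \<Rightarrow> real) \<Rightarrow> sc_state \<Rightarrow> bool" where
  "consistent v n es \<beta> st \<longleftrightarrow>
     distinct (map fst (fst st)) \<and>
     (\<forall>j. division v (\<beta> j) (snd st j)) \<and>
     (\<forall>j L. snd st j L \<noteq> 0 \<longrightarrow> j < length es \<and> (\<exists>s d b w. es ! j = Arrive s d b \<and>
        L = (w, sc_trail n s d) \<and> w \<in> labelled (fst st) (tr_class s d) (phase s d))) \<and>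
     (\<forall>L. load (snd st) L \<le> 1)"

lemma consistentD:
  assumes "consistent v n es \<beta> (ls, A)"
  shows "distinct (map fst ls)" "division v (\<beta> j) (A j)" "load A L \<le> 1"
    "A j L \<noteq> 0 \<Longrightarrow> j < length es"
    "A j L \<noteq> 0 \<Longrightarrow> \<exists>s d b w. es ! j = Arrive s d b \<and> L = (w, sc_trail n s d) \<and>
       w \<in> labelled ls (tr_class s d) (phase s d)"
  using assms unfolding consistent_def fst_conv snd_conv by blast+

lemma consistentI:
  assumes "distinct (map fst ls)" "\<And>j. division v (\<beta> j) (A j)" "\<And>L. load A L \<le> 1"
    "\<And>j L. A j L \<noteq> 0 \<Longrightarrow> j < length es \<and> (\<exists>s d b w. es ! j = Arrive s d b \<and>
       L = (w, sc_trail n s d) \<and> w \<in> labelled ls (tr_class s d) (phase s d))"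
  shows "consistent v n es \<beta> (ls, A)"
  using assms unfolding consistent_def fst_conv snd_conv by blast

lemma division_nonneg: "division v b f \<Longrightarrow> 0 \<le> b"
  using divisionD(2,3)[of v b f] by (metis sum_nonneg)

lemma division_0:
  assumes "division v 0 f"
  shows "f L = 0"
proof (rule ccontr)
  assume nz: "f L \<noteq> 0"
  have "f L \<le> (\<Sum>L | f L \<noteq> 0. f L)"
    using nz divisionD(1,2)[OF assms] by (intro member_le_sum) auto
  with divisionD(2,3)[OF assms] nz show False by (metis order_antisym)
qed

lemma consistent_support:
  assumes "consistent v n es \<beta> (ls, A)"
  shows "finite {j. A j L \<noteq> 0}"
proof (rule finite_subset)
  show "{j. A j L \<noteq> 0} \<subseteq> {..<length es}" using consistentD(4)[OF assms] by blast
qed simp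

text \<open>\<open>assign\<close> overwrites an entry instead of adding to it, so the load grows by
  \<open>a\<close> only if \<open>j\<close> had nothing on \<open>L\<close> before.\<close>

lemma load_assign:
  assumes "finite {i. A i L \<noteq> 0}" "A j L = 0"
  shows "load (assign A j L a) L = load A L + a"
proof -
  let ?F = "{i. A i L \<noteq> 0}"
  have "load (assign A j L a) L = (\<Sum>i\<in>insert j ?F. assign A j L a i L)"
    using assms by (intro load_eq_sum) (auto simp: assign_def)
  also have "\<dots> = a + (\<Sum>i\<in>?F. assign A j L a i L)"
    using assms by (subst sum.insert) (auto simp: assign_def)
  also have "(\<Sum>i\<in>?F. assign A j L a i L) = (\<Sum>i\<in>?F. A i L)"
    using assms by (intro sum.cong) (auto simp: assign_def)
  finally show ?thesis by (simp add: load_def)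
qed

lemma assign_apply: "assign A j L a i L' = (if i = j \<and> L' = L then a else A i L')"
  by (simp add: assign_def)

lemma load_assign_other: "L' \<noteq> L \<Longrightarrow> load (assign A j L a) L' = load A L'"
  by (simp add: load_def assign_apply)

text \<open>Covers both ways of placing a piece: on a labelled wavelength, with
  \<open>ls' = ls\<close>, and on a new one, with \<open>ls'\<close> longer by one entry. The
  condition on \<open>\<beta> j\<close> keeps an unsplittable transmission on a single
  trail.\<close>

lemma consistent_assign:
  assumes C: "consistent v n es \<beta> (ls, A)"
    and j: "j < length es" "es ! j = Arrive s d b"
    and L: "L = (w, sc_trail n s d)" "w \<in> labelled ls' (tr_class s d) (phase s d)"
    and ls': "set ls \<subseteq> set ls'" "distinct (map fst ls')"
    and a: "A j L = 0" "0 < a" "load A L + a \<le> 1" "v = NonSplittable \<Longrightarrow> \<beta> j = 0"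
  shows "consistent v n es (\<beta>(j := \<beta> j + a)) (ls', assign A j L a)"
proof (rule consistentI)
  fix i
  have D: "division v (\<beta> j) (A j)" by (rule consistentD(2)[OF C])
  have "division v (\<beta> j + a) ((A j)(L := a))"
  proof (cases v)
    case NonSplittable
    with D a(4) have "A j = (\<lambda>_. 0)" by (intro ext division_0[of v]) simp
    with division_single[of a v L] a NonSplittable show ?thesis by simp
  next
    case Splittable
    let ?F = "{L. A j L \<noteq> 0}"
    have eq: "{L'. ((A j)(L := a)) L' \<noteq> 0} = insert L ?F" using a by auto
    have "(\<Sum>L'\<in>insert L ?F. ((A j)(L := a)) L') = a + (\<Sum>L'\<in>?F. ((A j)(L := a)) L')"
      using a divisionD(1)[OF D] by (subst sum.insert) simp_all
    also have "(\<Sum>L'\<in>?F. ((A j)(L := a)) L') = (\<Sum>L'\<in>?F. A j L')"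
      using a by (intro sum.cong) auto
    finally have "(\<Sum>L'\<in>insert L ?F. ((A j)(L := a)) L') = \<beta> j + a"
      using divisionD(3)[OF D] by simp
    then show ?thesis
      unfolding division_def eq using divisionD(1,2)[OF D] a Splittable by simp
  qed
  then show "division v ((\<beta>(j := \<beta> j + a)) i) (assign A j L a i)"
    using consistentD(2)[OF C, of i] by (simp add: assign_def)
next
  fix L'
  show "load (assign A j L a) L' \<le> 1"
    using load_assign[where A = A and L = L, OF consistent_support[OF C] a(1)]
      load_assign_other[of L' L A j a]
      consistentD(3)[OF C, of L'] a(3) by (cases "L' = L") simp_all
next
  fix i L'
  assume nz: "assign A j L a i L' \<noteq> 0"
  show "i < length es \<and> (\<exists>s d b w. es ! i = Arrive s d b \<and>
       L' = (w, sc_trail n s d) \<and> w \<in> labelled ls' (tr_class s d) (phase s d))"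
  proof (cases "i = j \<and> L' = L")
    case True
    with j L show ?thesis by blast
  next
    case False
    with nz have "A i L' \<noteq> 0" by (auto simp: assign_apply)
    with consistentD(4,5)[OF C, of i L'] ls'(1) show ?thesis
      unfolding labelled_def by blast
  qed
qed (rule ls'(2))

text \<open>The invariant of the recursion in \<open>sc_serve\<close>. While some bandwidth remains
  to be placed, every trail already used by \<open>j\<close> is full; so a trail with space holds
  nothing of \<open>j\<close>, and without splitting nothing has been placed yet.\<close>

definition serving ::
    "variation \<Rightarrow> nat \<Rightarrow> event list \<Rightarrow> (nat \<Rightarrow> real) \<Rightarrow> nat \<Rightarrow> nat \<Rightarrow> nat \<Rightarrow> real \<Rightarrow> sc_state \<Rightarrow> bool" where
  "serving v n es \<beta> j s d r st \<longleftrightarrow>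
     j < length es \<and> (\<exists>b\<le>1. es ! j = Arrive s d b \<and> \<beta> j + r = b) \<and> 0 \<le> r \<and>
     consistent v n es \<beta> st \<and>
     (0 < r \<longrightarrow> (\<forall>L. snd st j L \<noteq> 0 \<longrightarrow> v = Splittable \<and> load (snd st) L = 1))"

lemma servingD:
  assumes "serving v n es \<beta> j s d r (ls, A)"
  shows "j < length es" "\<exists>b. es ! j = Arrive s d b" "\<beta> j + r \<le> 1" "0 \<le> r"
    "consistent v n es \<beta> (ls, A)"
    "0 < r \<Longrightarrow> A j L \<noteq> 0 \<Longrightarrow> v = Splittable \<and> load A L = 1"
  using assms unfolding serving_def snd_conv by blast+

lemma serving_NonSplittable:
  assumes "serving v n es \<beta> j s d r (ls, A)" "0 < r" "v = NonSplittable"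
  shows "\<beta> j = 0"
proof -
  have "A j L = 0" for L using servingD(6)[OF assms(1,2), of L] assms(3) by auto
  then show ?thesis using divisionD(3)[OF consistentD(2)[OF servingD(5)[OF assms(1)], of j]] by simp
qed

text \<open>Either the whole remainder fits and nothing is left to serve, or the piece fills the
  trail, as the invariant demands. The second claim also serves as the termination measure in
  \<open>sc_serve_exists\<close>.\<close>

lemma serving_found:
  assumes S: "serving v n es \<beta> j s d r (ls, A)" and r: "0 < r"
    and w: "w \<in> set (candidates v n s d r (ls, A))"
    and L: "L = (w, sc_trail n s d)" and a: "a = min r (1 - load A L)"
  shows "serving v n es (\<beta>(j := \<beta> j + a)) j s d (r - a) (ls, assign A j L a)"
    and "a < r \<Longrightarrow> load A L < 1 \<and> load (assign A j L a) L = 1"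
    and "v = NonSplittable \<Longrightarrow> a = r"
proof -
  note C = servingD(5)[OF S]
  have sp: "w \<in> labelled ls (tr_class s d) (phase s d)" "has_space v (load A L) r"
    using w L by (simp_all add: mem_candidates)
  have lt: "load A L < 1" and ns: "v = NonSplittable \<Longrightarrow> a = r"
    using sp(2) r a unfolding has_space_def by (cases v; simp)+
  have z: "A j L = 0" using servingD(6)[OF S r, of L] lt by auto
  have a0: "0 < a" and la: "load A L + a \<le> 1" using r lt a by auto
  obtain b where b: "es ! j = Arrive s d b" "b \<le> 1" "\<beta> j + r = b"
    using S unfolding serving_def by blast
  have load: "load (assign A j L a) L = load A L + a"
    by (rule load_assign[where A = A and L = L, OF consistent_support[OF C] z])
  show full: "a < r \<Longrightarrow> load A L < 1 \<and> load (assign A j L a) L = 1"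
    using load lt a by auto
  show "v = NonSplittable \<Longrightarrow> a = r" by (rule ns)
  have "consistent v n es (\<beta>(j := \<beta> j + a)) (ls, assign A j L a)"
    using consistentD(1)[OF C] serving_NonSplittable[OF S r]
    by (intro consistent_assign[OF C servingD(1)[OF S] b(1) L sp(1) _ _ z a0 la]) auto
  moreover have "v = Splittable \<and> load (assign A j L a) L' = 1"
    if "0 < r - a" "assign A j L a j L' \<noteq> 0" for L'
  proof (cases "L' = L")
    case True
    have "v = Splittable" using that(1) ns by (cases v) auto
    with full that(1) True show ?thesis by simp
  next
    case False
    with that(2) servingD(6)[OF S r, of L'] load_assign_other[OF False, of A j a]
    show ?thesis by (simp add: assign_apply)
  qed
  moreover have "0 \<le> r - a" using a by simp
  ultimately show "serving v n es (\<beta>(j := \<beta> j + a)) j s d (r - a) (ls, assign A j L a)"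
    using b servingD(1)[OF S] unfolding serving_def snd_conv by auto
qed

lemma unlabelled_empty:
  assumes "consistent v n es \<beta> (ls, A)" "w \<notin> fst ` set ls"
  shows "A j (w, x) = 0"
proof (rule ccontr)
  assume "A j (w, x) \<noteq> 0"
  from consistentD(5)[OF assms(1) this] assms(2) show False
    unfolding labelled_def by force
qed

text \<open>An unlabelled wavelength is empty, and the remainder is at most 1, so it fits there as a
  whole.\<close>

lemma serving_fresh:
  assumes S: "serving v n es \<beta> j s d r (ls, A)" and r: "0 < r"
    and w: "w \<notin> fst ` set ls"
  shows "consistent v n es (\<beta>(j := \<beta> j + r))
    (ls @ [(w, tr_class s d, phase s d)], assign A j (w, sc_trail n s d) r)"
proof -
  note C = servingD(5)[OF S]
  obtain b where b: "es ! j = Arrive s d b" using servingD(2)[OF S] by blast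
  have z: "A i (w, sc_trail n s d) = 0" for i by (rule unlabelled_empty[OF C w])
  then have "load A (w, sc_trail n s d) = 0" by (simp add: load_def)
  moreover have "0 \<le> \<beta> j" using division_nonneg consistentD(2)[OF C] by blast
  ultimately show ?thesis
    using servingD(3)[OF S] consistentD(1)[OF C] w serving_NonSplittable[OF S r]
    by (intro consistent_assign[OF C servingD(1)[OF S] b refl _ _ _ z r])
      (auto simp: labelled_def)
qed

lemma sc_serve_consistent:
  assumes "sc_serve v ord n j s d r st st'" "serving v n es \<beta> j s d r st"
  shows "consistent v n es (\<beta>(j := \<beta> j + r)) st'"
  using assms
proof (induction arbitrary: \<beta> rule: sc_serve.induct)
  case (served st)
  then show ?case by (simp add: serving_def)
next
  case (found r ls A w L a st')
  from serving_found(1)[OF found.prems found.hyps(1) chosen_in_set[OF found.hyps(2)] found.hyps(3,4)]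
  have "consistent v n es ((\<beta>(j := \<beta> j + a))(j := (\<beta>(j := \<beta> j + a)) j + (r - a))) st'"
    by (rule found.IH)
  then show ?case by (simp add: fun_upd_def cong: if_cong)
next
  case (fresh r ls A w)
  then show ?case by (intro serving_fresh)
qed

text \<open>An arrival adds at most one label. The intermediate state \<open>(fst st, A)\<close>
  just before that is recorded because there no trail has space; the equation for
  \<open>\<gamma>\<close> says that the bandwidth still to be placed is exactly what completes the
  event.\<close>

lemma sc_serve_labels:
  assumes "sc_serve v ord n j s d r st st'" "serving v n es \<beta> j s d r st"
  shows "fst st' = fst st \<or> (\<exists>w \<gamma> r' A. fst st' = fst st @ [(w, tr_class s d, phase s d)] \<and>
    0 < r' \<and> serving v n es \<gamma> j s d r' (fst st, A) \<and> \<gamma>(j := \<gamma> j + r') = \<beta>(j := \<beta> j + r) \<and>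
    candidates v n s d r' (fst st, A) = [])"
  using assms
proof (induction arbitrary: \<beta> rule: sc_serve.induct)
  case (found r ls A w L a st')
  let ?\<beta> = "\<beta>(j := \<beta> j + a)"
  have "?\<beta>(j := ?\<beta> j + (r - a)) = \<beta>(j := \<beta> j + r)" by auto
  with found.IH[OF serving_found(1)[OF found.prems found.hyps(1)
      chosen_in_set[OF found.hyps(2)] found.hyps(3,4)]]
  show ?case by (simp only: fst_conv)
next
  case (fresh r ls A w)
  then show ?case by (simp only: fst_conv) blast
qed simp

text \<open>A piece smaller than the remainder fills its trail, so the number of labelled
  wavelengths with room on the trail in question decreases and the recursion ends.\<close>

lemma sc_serve_exists:
  assumes "serving v n es \<beta> j s d r (ls, A)"
  shows "\<exists>st'. sc_serve v ord n j s d r (ls, A) st'"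
  using assms
proof (induction "card {w \<in> fst ` set ls. load A (w, sc_trail n s d) < 1}" arbitrary: \<beta> r A
    rule: less_induct)
  case less
  let ?ws = "candidates v n s d r (ls, A)"
  consider "r = 0" | "0 < r" "?ws = []" | "0 < r" "?ws \<noteq> []"
    using servingD(4)[OF less.prems] by force
  then show ?case
  proof cases
    case 1
    then show ?thesis using sc_serve.served by blast
  next
    case 2
    obtain w where "w \<notin> fst ` set ls"
      using ex_new_if_finite[OF infinite_UNIV_nat, of "fst ` set ls"] by auto
    with 2 show ?thesis using sc_serve.fresh by blast
  next
    case 3
    define w where "w = hd ?ws"
    define L where "L = (w, sc_trail n s d)"
    define a where "a = min r (1 - load A L)"
    have ch: "chosen ord ?ws w" unfolding w_def by (rule chosen_hd[OF 3(2)])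
    then have w: "w \<in> set ?ws" by (rule chosen_in_set)
    note F = serving_found[OF less.prems 3(1) w L_def a_def]
    have "\<exists>st'. sc_serve v ord n j s d (r - a) (ls, assign A j L a) st'"
    proof (cases "a = r")
      case True
      then show ?thesis using sc_serve.served[of v ord n j s d] by (simp only: diff_self) blast
    next
      case False
      then have "a < r" by (simp add: a_def)
      note full = F(2)[OF this]
      let ?M = "\<lambda>A. {w \<in> fst ` set ls. load A (w, sc_trail n s d) < 1}"
      have "w \<in> fst ` set ls" using w by (force simp: mem_candidates labelled_def)
      with full have mem: "w \<in> ?M A" "w \<notin> ?M (assign A j L a)" by (simp_all add: L_def)
      have "?M (assign A j L a) \<subseteq> ?M A"
      proof
        fix w' assume w': "w' \<in> ?M (assign A j L a)"
        with mem have "w' \<noteq> w" by blast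
        then have "load (assign A j L a) (w', sc_trail n s d) = load A (w', sc_trail n s d)"
          by (intro load_assign_other) (simp add: L_def)
        with w' show "w' \<in> ?M A" by simp
      qed
      with mem have "?M (assign A j L a) \<subset> ?M A" by blast
      then have "card (?M (assign A j L a)) < card (?M A)" by (intro psubset_card_mono) simp_all
      from less.hyps[OF this F(1)] show ?thesis .
    qed
    with sc_serve.found[OF 3(1) ch L_def a_def] show ?thesis by blast
  qed
qed

section \<open>Runs\<close>

lemma serving_start:
  assumes R: "requests n es" and t: "t < length es" "es ! t = Arrive s d b"
    and C: "consistent v n es (bw es t) st"
  shows "serving v n es (bw es t) t s d b st"
proof -
  have z: "bw es t t = 0" by (simp add: bw_def)
  obtain ls A where st: "st = (ls, A)" by (cases st)
  have "A t L = 0" for L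
    using division_0[of v "A t" L] consistentD(2)[OF C[unfolded st], of t] z by simp
  with z C t requests_Arrive[OF R t] show ?thesis unfolding serving_def st snd_conv by auto
qed

text \<open>Only wavelengths that have become empty lose their labels, so whatever is still placed
  keeps its label.\<close>

lemma sc_depart_consistent:
  fixes A :: allocation and j :: nat
  assumes C: "consistent v n es \<beta> (ls, A)"
  defines "A' \<equiv> A(j := (\<lambda>_. 0))"
  shows "consistent v n es (\<beta>(j := 0)) (filter (\<lambda>(w, _). w \<in> in_use A') ls, A')"
proof (rule consistentI)
  show "distinct (map fst (filter (\<lambda>(w, _). w \<in> in_use A') ls))"
    using consistentD(1)[OF C] by (rule distinct_map_filter)
next
  fix i
  show "division v ((\<beta>(j := 0)) i) (A' i)"
    using consistentD(2)[OF C, of i] division_zero by (simp add: A'_def)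
next
  fix L
  have "load A' L = (\<Sum>i | A i L \<noteq> 0. A' i L)"
    using consistent_support[OF C] by (intro load_eq_sum) (auto simp: A'_def)
  also have "\<dots> \<le> (\<Sum>i | A i L \<noteq> 0. A i L)"
    using divisionD(2)[OF consistentD(2)[OF C]] by (intro sum_mono) (simp add: A'_def)
  also have "\<dots> \<le> 1" using consistentD(3)[OF C, of L] by (simp add: load_def)
  finally show "load A' L \<le> 1" .
next
  fix i L
  assume nz: "A' i L \<noteq> 0"
  then have "A i L \<noteq> 0" by (simp add: A'_def split: if_splits)
  from consistentD(4,5)[OF C this] obtain s d b w where *: "i < length es"
    "es ! i = Arrive s d b" "L = (w, sc_trail n s d)" "w \<in> labelled ls (tr_class s d) (phase s d)"
    by blast
  moreover have "w \<in> in_use A'" unfolding in_use_def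
    using nz *(3) by (cases "sc_trail n s d") auto
  ultimately show "i < length es \<and> (\<exists>s d b w. es ! i = Arrive s d b \<and>
       L = (w, sc_trail n s d) \<and>
       w \<in> labelled (filter (\<lambda>(w, _). w \<in> in_use A') ls) (tr_class s d) (phase s d))"
    by (auto simp: labelled_def)
qed

lemma sc_step_consistent:
  assumes R: "requests n es" and t: "t < length es"
    and C: "consistent v n es (bw es t) st" and step: "sc_step v ord n t (es ! t) st st'"
  shows "consistent v n es (bw es (Suc t)) st'"
proof (cases "es ! t")
  case (Arrive s d b)
  with step have "sc_serve v ord n t s d b st st'" by simp
  from sc_serve_consistent[OF this serving_start[OF R t Arrive C]]
  have "consistent v n es ((bw es t)(t := bw es t t + b)) st'" .
  then show ?thesis by (simp add: bw_Arrive[OF R t Arrive] bw_def[of es t t])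
next
  case (Depart j)
  obtain ls A where st: "st = (ls, A)" by (cases st)
  from step Depart have "st' = (filter (\<lambda>(w, _). w \<in> in_use (A(j := (\<lambda>_. 0)))) ls, A(j := (\<lambda>_. 0)))"
    by (simp add: st Let_def)
  with sc_depart_consistent[OF C[unfolded st], of j] show ?thesis
    by (simp add: bw_Depart[OF R t Depart])
qed

lemma consistent_init: "consistent v n es (bw es 0) ([], \<lambda>_ _. 0)"
  by (rule consistentI) (simp_all add: division_zero load_def)

lemma sc_run_consistent:
  assumes "requests n es" "sc_run v ord n es S" "t \<le> length es"
  shows "consistent v n es (bw es t) (S t)"
  using assms(3)
proof (induction t)
  case 0
  then show ?case using assms(2) consistent_init by (simp add: sc_run_def)
next
  case (Suc t)
  then have "sc_step v ord n t (es ! t) (S t) (S (Suc t))" using assms(2) by (simp add: sc_run_def)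
  from sc_step_consistent[OF assms(1) _ _ this] Suc show ?case by simp
qed

text \<open>A step is guaranteed only from a consistent state, so consistency is carried along in
  the dependent choice. Beyond the end of \<open>es\<close> the states are arbitrary.\<close>

lemma sc_run_exists:
  assumes R: "requests n es"
  shows "\<exists>S. sc_run v ord n es S"
proof -
  have "\<exists>S. \<forall>t. (t = 0 \<longrightarrow> S t = ([], \<lambda>_ _. 0)) \<and>
      (t \<le> length es \<longrightarrow> consistent v n es (bw es t) (S t)) \<and>
      (t < length es \<longrightarrow> sc_step v ord n t (es ! t) (S t) (S (Suc t)))"
  proof -
    let ?P = "\<lambda>t st. (t = 0 \<longrightarrow> st = ([], \<lambda>_ _. 0)) \<and>
      (t \<le> length es \<longrightarrow> consistent v n es (bw es t) st)"
    let ?Q = "\<lambda>t st st'. t < length es \<longrightarrow> sc_step v ord n t (es ! t) st st'"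
    have "\<exists>S. \<forall>t. ?P t (S t) \<and> ?Q t (S t) (S (Suc t))"
    proof (rule dependent_nat_choice)
      show "\<exists>st. ?P 0 st" using consistent_init by blast
    next
      fix st t assume P: "?P t st"
      show "\<exists>st'. ?P (Suc t) st' \<and> ?Q t st st'"
      proof (cases "t < length es")
        case False
        then show ?thesis by simp
      next
        case True
        with P have C: "consistent v n es (bw es t) st" by simp
        obtain ls A where st: "st = (ls, A)" by (cases st)
        have "\<exists>st'. sc_step v ord n t (es ! t) st st'"
        proof (cases "es ! t")
          case (Arrive s d b)
          from sc_serve_exists[OF serving_start[OF R True Arrive C, unfolded st]]
          show ?thesis by (simp add: Arrive st)
        qed (simp add: st Let_def)
        then obtain st' where step: "sc_step v ord n t (es ! t) st st'" by blast
        with sc_step_consistent[OF R True C step] show ?thesis by blast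
      qed
    qed
    then show ?thesis by blast
  qed
  then show ?thesis unfolding sc_run_def by blast
qed

section \<open>Upper bound\<close>

lemma label_unique:
  assumes "distinct (map fst ls)" "w \<in> labelled ls i p" "w \<in> labelled ls i' p'"
  shows "i' = i" "p' = p"
  using assms eq_key_imp_eq_value[of ls w "(i, p)" "(i', p')"] by (simp_all add: labelled_def)

text \<open>The light-trail reveals the trail-point of its occupant, and the unique label of the
  wavelength reveals the class.\<close>

lemma occupant_peer:
  assumes C: "consistent v n es \<beta> (ls, A)"
    and w: "w \<in> labelled ls (tr_class s d) (phase s d)" and nz: "A j (w, sc_trail n s d) \<noteq> 0"
  shows "j \<in> peers es s d"
proof -
  from consistentD(4,5)[OF C nz] obtain s' d' b w' where *: "j < length es"
    "es ! j = Arrive s' d' b" "(w, sc_trail n s d) = (w', sc_trail n s' d')"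
    "w' \<in> labelled ls (tr_class s' d') (phase s' d')" by blast
  from * have "w' = w" "trail_point s' d' = trail_point s d" by (simp_all add: sc_trail_def)
  moreover from this * have "tr_class s' d' = tr_class s d"
    using label_unique(1)[OF consistentD(1)[OF C] w] by blast
  ultimately show ?thesis using * by (auto simp: peers_def)
qed

text \<open>Double counting: the loads on these trails consist of bandwidth of peers, and a peer
  contributes at most \<open>\<beta> j\<close> over all of them. The threshold
  \<open>\<theta>\<close> is 1 with splitting and 1/2 without.\<close>

lemma full_trails:
  assumes C: "consistent v n es \<beta> (ls, A)"
    and W: "W \<subseteq> labelled ls (tr_class s d) (phase s d)"
      "\<And>w. w \<in> W \<Longrightarrow> \<theta> \<le> load A (w, sc_trail n s d)"
  shows "\<theta> * card W \<le> (\<Sum>j\<in>peers es s d. \<beta> j)"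
proof -
  let ?L = "\<lambda>w. (w, sc_trail n s d)"
  have fW: "finite W" using W(1) by (rule finite_subset) simp
  have "\<theta> * card W = (\<Sum>w\<in>W. \<theta>)" by simp
  also have "\<dots> \<le> (\<Sum>w\<in>W. load A (?L w))" using W(2) by (intro sum_mono)
  also have "\<dots> = (\<Sum>w\<in>W. \<Sum>j\<in>peers es s d. A j (?L w))"
    using occupant_peer[OF C subsetD[OF W(1)]]
    by (intro sum.cong refl load_eq_sum finite_peers) blast
  also have "\<dots> = (\<Sum>j\<in>peers es s d. \<Sum>w\<in>W. A j (?L w))" by (rule sum.swap)
  also have "\<dots> = (\<Sum>j\<in>peers es s d. \<Sum>L\<in>?L ` W. A j L)"
    by (intro sum.cong refl) (simp add: sum.reindex inj_on_def)
  also have "\<dots> \<le> (\<Sum>j\<in>peers es s d. \<beta> j)"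
    using fW by (intro sum_mono division_sum_le[OF consistentD(2)[OF C]]) simp
  finally show ?thesis .
qed

text \<open>The unplaced bandwidth \<open>r\<close> uses the common link too and comes on top of the
  loads. The sum is the congestion after the event, which \<open>opt\<close> bounds; a positive
  \<open>r\<close> later makes the bounds strict.\<close>

lemma full_trails_opt:
  assumes n: "2 \<le> n" and R: "requests n es" and t: "t < length es"
    and S: "serving v n es \<beta> t s d r (ls, A)" and \<beta>: "\<beta>(t := \<beta> t + r) = bw es (Suc t)"
    and W: "W \<subseteq> labelled ls (tr_class s d) (phase s d)"
      "\<And>w. w \<in> W \<Longrightarrow> \<theta> \<le> load A (w, sc_trail n s d)"
  shows "\<theta> * card W + r \<le> opt v n es"
proof -
  let ?P = "peers es s d"
  obtain b where b: "es ! t = Arrive s d b" using servingD(2)[OF S] by blast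
  have tP: "t \<in> ?P" using b t by (simp add: peers_def)
  have "\<theta> * card W + r \<le> (\<Sum>j\<in>?P. \<beta> j) + r"
    using full_trails[OF servingD(5)[OF S] W] by simp
  also have "\<dots> = (\<Sum>j\<in>?P. (\<beta>(t := \<beta> t + r)) j)"
    using tP finite_peers[of es s d] by (simp add: sum.remove)
  also have "\<dots> = (\<Sum>j\<in>?P. bw es (Suc t) j)" by (simp only: \<beta>)
  also have "\<dots> \<le> opt v n es"
    using t by (intro congestion_le_opt[OF n R _ peers_link[OF R]]) simp
  finally show ?thesis .
qed

lemma labelled_snoc:
  "labelled (ls @ [(w, i, p)]) i' p' =
     (if i' = i \<and> p' = p then insert w (labelled ls i' p') else labelled ls i' p')"
  by (auto simp: labelled_def)

lemma card_labelled_snoc: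
  assumes "card (labelled ls i' p') \<le> k" "card (labelled ls i p) < k"
  shows "card (labelled (ls @ [(w, i, p)]) i' p') \<le> k"
proof (cases "i' = i \<and> p' = p")
  case True
  then have "card (labelled (ls @ [(w, i, p)]) i' p') \<le> Suc (card (labelled ls i p))"
    by (simp add: labelled_snoc card_insert_if)
  with assms(2) show ?thesis by simp
next
  case False
  then have "labelled (ls @ [(w, i, p)]) i' p' = labelled ls i' p'" by (auto simp: labelled_snoc)
  with assms(1) show ?thesis by simp
qed

lemma candidates_Nil:
  assumes "candidates v n s d r (ls, A) = []" "w \<in> labelled ls (tr_class s d) (phase s d)"
  shows "\<not> has_space v (load A (w, sc_trail n s d)) r"
  using mem_candidates[of w v n s d r ls A] assms by simp

text \<open>A splittable transmission finds no space only on full trails. Strictness, from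
  \<open>0 < r\<close>, leaves room for the wavelength about to be labelled.\<close>

lemma full_count_less_opt:
  assumes "2 \<le> n" "requests n es" "t < length es" "serving Splittable n es \<beta> t s d r (ls, A)"
    and "\<beta>(t := \<beta> t + r) = bw es (Suc t)" "0 < r"
    and none: "candidates Splittable n s d r (ls, A) = []"
  shows "card (labelled ls (tr_class s d) (phase s d)) < opt Splittable n es"
proof -
  let ?W = "labelled ls (tr_class s d) (phase s d)"
  have "1 \<le> load A (w, sc_trail n s d)" if "w \<in> ?W" for w
    using candidates_Nil[OF none that] by (simp add: has_space_def)
  from full_trails_opt[OF assms(1-5) order_refl this] assms(6) show ?thesis by simp
qed

text \<open>Departures only remove labels, so the bound needs an argument only when a label is
  added. The order of search does not enter.\<close>

lemma sc_run_labelled_Splittable: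
  assumes n: "2 \<le> n" and R: "requests n es" and t: "t \<le> length es"
    and S: "sc_run Splittable ord n es S"
  shows "card (labelled (fst (S t)) i p) \<le> opt Splittable n es"
  using t
proof (induction t)
  case 0
  then show ?case using S by (simp add: sc_run_def labelled_def)
next
  case (Suc t)
  then have t: "t < length es"
    and IH: "card (labelled (fst (S t)) i p) \<le> opt Splittable n es" by simp_all
  have step: "sc_step Splittable ord n t (es ! t) (S t) (S (Suc t))"
    using S t by (simp add: sc_run_def)
  show ?case
  proof (cases "es ! t")
    case (Arrive s d b)
    have "bw es t t = 0" by (simp add: bw_def)
    then have bw: "(bw es t)(t := bw es t t + b) = bw es (Suc t)"
      by (simp add: bw_Arrive[OF R t Arrive])
    have "serving Splittable n es (bw es t) t s d b (S t)"
      using t by (intro serving_start[OF R t Arrive] sc_run_consistent[OF R S]) simp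
    moreover have "sc_serve Splittable ord n t s d b (S t) (S (Suc t))"
      using step by (simp add: Arrive)
    ultimately consider "fst (S (Suc t)) = fst (S t)" | w \<gamma> r A where
      "fst (S (Suc t)) = fst (S t) @ [(w, tr_class s d, phase s d)]" "0 < r"
      "serving Splittable n es \<gamma> t s d r (fst (S t), A)" "\<gamma>(t := \<gamma> t + r) = bw es (Suc t)"
      "candidates Splittable n s d r (fst (S t), A) = []"
      using sc_serve_labels[of Splittable ord n t s d b "S t" "S (Suc t)" es "bw es t"]
      unfolding bw by blast
    then show ?thesis
    proof cases
      case 1
      with IH show ?thesis by simp
    next
      case 2
      from full_count_less_opt[OF n R t 2(3,4,2,5)] show ?thesis
        unfolding 2(1) by (rule card_labelled_snoc[OF IH])
    qed
  next
    case (Depart j)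
    obtain ls A where st: "S t = (ls, A)" by (cases "S t")
    have "set (fst (S (Suc t))) \<subseteq> set ls" using step by (auto simp: Depart st Let_def)
    then have "card (labelled (fst (S (Suc t))) i p) \<le> card (labelled ls i p)"
      by (intro card_mono finite_labelled) (auto simp: labelled_def)
    with IH st show ?thesis by simp
  qed
qed

section \<open>First fit without splitting\<close>

text \<open>A candidate has room for the whole transmission, so the recursion stops after one
  placement.\<close>

lemma sc_serve_NonSplittable:
  assumes "sc_serve NonSplittable ord n j s d r (ls, A) st'" "0 < r"
  obtains (found) w where "chosen ord (candidates NonSplittable n s d r (ls, A)) w"
      "st' = (ls, assign A j (w, sc_trail n s d) r)"
    | (fresh) w where "candidates NonSplittable n s d r (ls, A) = []" "w \<notin> fst ` set ls"
      "st' = (ls @ [(w, tr_class s d, phase s d)], assign A j (w, sc_trail n s d) r)"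
  using assms(1)
proof cases
  case served
  with assms(2) show ?thesis by simp
next
  case (found w L a)
  then have "has_space NonSplittable (load A L) r"
    using chosen_in_set mem_candidates by blast
  then have "a = r" using found(4) by (simp add: has_space_def)
  with found(5) have "sc_serve NonSplittable ord n j s d 0 (ls, assign A j L r) st'" by simp
  then have "st' = (ls, assign A j L r)" by cases auto
  with that(1) found show ?thesis by blast
next
  case (fresh w)
  with that(2) show ?thesis by blast
qed

text \<open>
  First fit puts a transmission of bandwidth at most 1/2 on a wavelength only if the trail is more
  than half full on all earlier wavelengths with the same labels; as the list of wavelengths only
  loses elements and grows at its end, the number of these predecessors never increases later.
\<close>

definition first_fit :: "nat \<Rightarrow> event list \<Rightarrow> nat \<Rightarrow> sc_state \<Rightarrow> bool" where
  "first_fit n es k st \<longleftrightarrow> (\<forall>us w vs j s d b.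
     fst st = us @ (w, tr_class s d, phase s d) # vs \<longrightarrow> snd st j (w, sc_trail n s d) \<noteq> 0 \<longrightarrow>
     es ! j = Arrive s d b \<longrightarrow> b \<le> 1 / 2 \<longrightarrow> card (labelled us (tr_class s d) (phase s d)) < 2 * k)"

lemma first_fitI:
  assumes "\<And>us w vs j s d b. ls = us @ (w, tr_class s d, phase s d) # vs \<Longrightarrow>
     A j (w, sc_trail n s d) \<noteq> 0 \<Longrightarrow> es ! j = Arrive s d b \<Longrightarrow> b \<le> 1 / 2 \<Longrightarrow>
     card (labelled us (tr_class s d) (phase s d)) < 2 * k"
  shows "first_fit n es k (ls, A)"
  using assms unfolding first_fit_def fst_conv snd_conv by blast

lemma first_fitD:
  assumes "first_fit n es k (ls, A)" "ls = us @ (w, tr_class s d, phase s d) # vs"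
    "A j (w, sc_trail n s d) \<noteq> 0" "es ! j = Arrive s d b" "b \<le> 1 / 2"
  shows "card (labelled us (tr_class s d) (phase s d)) < 2 * k"
  using assms unfolding first_fit_def fst_conv snd_conv by blast

lemma filter_eq_append_ConsD:
  assumes "filter P xs = us @ x # vs"
  shows "\<exists>us' vs'. xs = us' @ x # vs' \<and> us = filter P us'"
  using assms
proof (induction xs arbitrary: us)
  case (Cons y xs)
  show ?case
  proof (cases "P y \<and> us = []")
    case True
    with Cons.prems show ?thesis by (intro exI[of _ "[]"] exI[of _ xs]) simp
  next
    case False
    with Cons.prems have "filter P xs = (if P y then tl us else us) @ x # vs"
      by (cases us) auto
    from Cons.IH[OF this] obtain us' vs' where
      *: "xs = us' @ x # vs'" "(if P y then tl us else us) = filter P us'" by blast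
    have "us = filter P (y # us')"
      using False * Cons.prems by (cases us) (auto split: if_splits)
    with * show ?thesis by (intro exI[of _ "y # us'"] exI[of _ vs']) simp
  qed
qed simp

lemma first_fit_depart:
  assumes "first_fit n es k (ls, A)"
  shows "first_fit n es k (filter P ls, A(j := (\<lambda>_. 0)))"
proof (rule first_fitI)
  fix us w vs i s d b
  assume "filter P ls = us @ (w, tr_class s d, phase s d) # vs"
  from filter_eq_append_ConsD[OF this]
  obtain us' vs' where *: "ls = us' @ (w, tr_class s d, phase s d) # vs'" "us = filter P us'"
    by blast
  assume "(A(j := (\<lambda>_. 0))) i (w, sc_trail n s d) \<noteq> 0"
  then have "A i (w, sc_trail n s d) \<noteq> 0" by (simp split: if_splits)
  moreover assume "es ! i = Arrive s d b" "b \<le> 1 / 2"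
  ultimately have "card (labelled us' (tr_class s d) (phase s d)) < 2 * k"
    using first_fitD[OF assms *(1)] by blast
  moreover have "card (labelled us (tr_class s d) (phase s d)) \<le>
      card (labelled us' (tr_class s d) (phase s d))"
    using *(2) by (intro card_mono finite_labelled) (auto simp: labelled_def)
  ultimately show "card (labelled us (tr_class s d) (phase s d)) < 2 * k" by simp
qed

section \<open>One arrival under first fit\<close>

context
  fixes n es t s d b ls A
  assumes n: "2 \<le> n" and R: "requests n es" and t: "t < length es"
    and arr: "es ! t = Arrive s d b"
    and C: "consistent NonSplittable n es (bw es t) (ls, A)"
    and FF: "first_fit n es (opt NonSplittable n es) (ls, A)"
begin

private lemma t0: "A t L = 0"
  using division_0[of NonSplittable "A t" L] consistentD(2)[OF C, of t] by (simp add: bw_def)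

private lemma bw_occupant:
  assumes "A j L \<noteq> 0" "es ! j = Arrive s' d' b'"
  shows "A j L = b'" "bw es t j = b'"
proof -
  have "A j = (\<lambda>_. 0)(L := bw es t j)"
    by (rule division_NonSplittable[OF consistentD(2)[OF C] assms(1)])
  then have eq: "A j L = bw es t j" by simp
  with assms have "bw es t j \<noteq> 0" by simp
  then show "bw es t j = b'" using assms(2) by (simp add: bw_def split: if_splits)
  with eq show "A j L = b'" by simp
qed

text \<open>A trail without space for \<open>b\<close> carries more than \<open>1 - b\<close>, hence
  at least 1/2. The set \<open>W\<close> is left open because it is all wavelengths of the label in
  one use and only the predecessors of the chosen one in another.\<close>

lemma half_full_less:
  assumes b: "b \<le> 1 / 2"
    and W: "W \<subseteq> labelled ls (tr_class s d) (phase s d)"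
      "\<And>w. w \<in> W \<Longrightarrow> \<not> has_space NonSplittable (load A (w, sc_trail n s d)) b"
  shows "card W < 2 * opt NonSplittable n es"
proof -
  have "bw es t t = 0" by (simp add: bw_def)
  then have eq: "(bw es t)(t := bw es t t + b) = bw es (Suc t)"
    by (simp add: bw_Arrive[OF R t arr])
  have "1 / 2 \<le> load A (w, sc_trail n s d)" if "w \<in> W" for w
    using W(2)[OF that] b by (simp add: has_space_def)
  from full_trails_opt[OF n R t serving_start[OF R t arr C] eq W(1) this]
  have "1 / 2 * card W + b \<le> opt NonSplittable n es" .
  with requests_Arrive(3)[OF R t arr] have "real (card W) < real (2 * opt NonSplittable n es)"
    by simp
  then show ?thesis by (simp only: of_nat_less_iff)
qed

text \<open>Choose one big occupant for each wavelength in \<open>W\<close>; unsplit, they are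
  distinct. Together with the arriving transmission they are \<open>card W + 1\<close> big users of
  a common link.\<close>

lemma big_trails_less:
  assumes b: "1 / 2 < b"
    and W: "W \<subseteq> labelled ls (tr_class s d) (phase s d)"
      "\<And>w. w \<in> W \<Longrightarrow> \<exists>j. A j (w, sc_trail n s d) \<noteq> 0 \<and> 1 / 2 < bw es t j"
  shows "card W < opt NonSplittable n es"
proof -
  let ?L = "\<lambda>w. (w, sc_trail n s d)"
  obtain j where j: "\<And>w. w \<in> W \<Longrightarrow> A (j w) (?L w) \<noteq> 0" "\<And>w. w \<in> W \<Longrightarrow> 1 / 2 < bw es t (j w)"
    using W(2) by metis
  have inj: "inj_on j W"
  proof (rule inj_onI)
    fix w w' assume w: "w \<in> W" "w' \<in> W" "j w = j w'"
    have "A (j w) = (\<lambda>_. 0)(?L w := bw es t (j w))"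
      by (rule division_NonSplittable[OF consistentD(2)[OF C] j(1)[OF w(1)]])
    with j(1)[OF w(2)] w(3) show "w = w'" by (auto split: if_splits)
  qed
  have tj: "t \<notin> j ` W" using j(1) t0 by (metis imageE)
  have fin: "finite W" using W(1) by (rule finite_subset) simp
  have "j ` W \<subseteq> peers es s d" using occupant_peer[OF C subsetD[OF W(1)] j(1)] by blast
  moreover have "t \<in> peers es s d" using arr t by (simp add: peers_def)
  ultimately have "insert t (j ` W) \<subseteq> peers es s d" by simp
  moreover have "1 / 2 < bw es (Suc t) i" if "i \<in> insert t (j ` W)" for i
    using that b tj j(2) unfolding bw_Arrive[OF R t arr] by fastforce
  ultimately have "card (insert t (j ` W)) \<le> opt NonSplittable n es"
    using t by (intro big_le_opt[OF n R Suc_leI subset_trans[OF _ peers_link[OF R]]]) simp_all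
  with inj tj fin show ?thesis by (simp add: card_image)
qed

lemma first_fit_fresh_count:
  assumes none: "candidates NonSplittable n s d b (ls, A) = []"
  shows "card (labelled ls (tr_class s d) (phase s d)) < 3 * opt NonSplittable n es"
proof (cases "b \<le> 1 / 2")
  case True
  from half_full_less[OF True order_refl candidates_Nil[OF none]] show ?thesis by simp
next
  case False
  then have b: "1 / 2 < b" by simp
  let ?k = "opt NonSplittable n es"
  let ?W = "labelled ls (tr_class s d) (phase s d)"
  let ?L = "\<lambda>w. (w, sc_trail n s d)"
  define Big where "Big = {w \<in> ?W. \<exists>j. A j (?L w) \<noteq> 0 \<and> 1 / 2 < bw es t j}"
  have Big: "card Big < ?k" unfolding Big_def by (rule big_trails_less[OF b]) auto
  show ?thesis
  proof (cases "?W \<subseteq> Big")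
    case True
    then have "?W = Big" by (auto simp: Big_def)
    with Big show ?thesis by simp
  next
    case False
    let ?P = "\<lambda>x. fst x \<in> ?W - Big \<and> snd x = (tr_class s d, phase s d)"
    have "\<exists>x\<in>set ls. ?P x" using False by (force simp: labelled_def)
    \<comment> \<open>Let \<open>w\<close> be the last wavelength of this label that holds no big
      occupant on the trail; every later one with the label is then in \<open>Big\<close>.\<close>
    from split_list_last_prop[OF this] obtain ys x zs where ls: "ls = ys @ x # zs"
      and x: "?P x" and zs: "\<forall>z\<in>set zs. \<not> ?P z" by blast
    obtain w where w: "x = (w, tr_class s d, phase s d)" "w \<in> ?W" "w \<notin> Big"
      using x by (cases x) auto
    \<comment> \<open>An empty trail would have space since \<open>b \<le> 1\<close>, so
      \<open>w\<close> has an occupant there, necessarily a small one, to which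
      \<open>first_fit\<close> applies.\<close>
    have "\<not> has_space NonSplittable (load A (?L w)) b" by (rule candidates_Nil[OF none w(2)])
    then have "load A (?L w) \<noteq> 0"
      using requests_Arrive(4)[OF R t arr] by (auto simp: has_space_def)
    then obtain j where j: "A j (?L w) \<noteq> 0"
      unfolding load_def by (metis (mono_tags, lifting) Collect_empty_eq sum.empty)
    from consistentD(5)[OF C j] obtain s' d' b' where j': "es ! j = Arrive s' d' b'"
      "sc_trail n s d = sc_trail n s' d'" "w \<in> labelled ls (tr_class s' d') (phase s' d')"
      by auto
    note lab = label_unique[OF consistentD(1)[OF C] w(2) j'(3)]
    have "b' \<le> 1 / 2" using w(2,3) j bw_occupant(2)[OF j j'(1)] by (auto simp: Big_def)
    moreover have "ls = ys @ (w, tr_class s' d', phase s' d') # zs" using ls w(1) lab by simp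
    moreover have "A j (w, sc_trail n s' d') \<noteq> 0" using j j'(2) by simp
    ultimately have ys: "card (labelled ys (tr_class s d) (phase s d)) < 2 * ?k"
      using first_fitD[OF FF _ _ j'(1)] lab by metis
    have "?W \<subseteq> insert w (labelled ys (tr_class s d) (phase s d) \<union> Big)"
    proof
      fix u assume u: "u \<in> ?W"
      then have "(u, tr_class s d, phase s d) \<in> set ys \<union> {x} \<union> set zs"
        by (simp add: labelled_def ls)
      with zs u show "u \<in> insert w (labelled ys (tr_class s d) (phase s d) \<union> Big)"
        using w(1) by (force simp: labelled_def)
    qed
    moreover have "finite Big" by (rule finite_subset[of _ ?W]) (auto simp: Big_def)
    ultimately have "card ?W \<le> card (insert w (labelled ys (tr_class s d) (phase s d) \<union> Big))"
      by (intro card_mono) simp_all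
    also have "\<dots> \<le> Suc (card (labelled ys (tr_class s d) (phase s d) \<union> Big))"
      by (rule card_insert_le_m1[of "Suc _", simplified]) simp
    also have "\<dots> \<le> Suc (card (labelled ys (tr_class s d) (phase s d)) + card Big)"
      using card_Un_le by blast
    \<comment> \<open>At most \<open>2 * ?k - 1\<close> predecessors, \<open>w\<close> itself, and
      at most \<open>?k - 1\<close> in \<open>Big\<close>, hence at most \<open>3 * ?k - 1\<close>
      in all.\<close>
    finally show ?thesis using ys Big by linarith
  qed
qed

lemma first_fit_found:
  assumes "candidates NonSplittable n s d b (ls, A) \<noteq> []"
    and w: "w = hd (candidates NonSplittable n s d b (ls, A))"
  shows "first_fit n es (opt NonSplittable n es) (ls, assign A t (w, sc_trail n s d) b)"
proof (rule first_fitI)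
  fix us w' vs j s' d' b'
  assume ls: "ls = us @ (w', tr_class s' d', phase s' d') # vs"
    and nz: "assign A t (w, sc_trail n s d) b j (w', sc_trail n s' d') \<noteq> 0"
    and j: "es ! j = Arrive s' d' b'" and b': "b' \<le> 1 / 2"
  show "card (labelled us (tr_class s' d') (phase s' d')) < 2 * opt NonSplittable n es"
  proof (cases "A j (w', sc_trail n s' d') \<noteq> 0")
    case True
    from first_fitD[OF FF ls this j b'] show ?thesis .
  next
    case False
    with nz have "j = t" and w': "w' = w" by (auto simp: assign_apply split: if_splits)
    with j arr have eq: "s' = s" "d' = d" "b' = b" by simp_all
    let ?us = "candidates NonSplittable n s d b (us, A)"
    \<comment> \<open>A predecessor with space would come first among the candidates and be
      \<open>w\<close> itself, contrary to distinctness of the labelled wavelengths.\<close>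
    have "?us = []"
    proof (rule ccontr)
      assume ne: "?us \<noteq> []"
      have "candidates NonSplittable n s d b (ls, A) = ?us @
          candidates NonSplittable n s d b ((w', tr_class s' d', phase s' d') # vs, A)"
        by (simp add: ls candidates_def)
      with ne w have "w = hd ?us" by simp
      with ne have "w \<in> set ?us" by simp
      then have "w \<in> fst ` set us" unfolding mem_candidates labelled_def by force
      with consistentD(1)[OF C] show False by (simp add: ls w')
    qed
    moreover have "labelled us (tr_class s d) (phase s d) \<subseteq> labelled ls (tr_class s d) (phase s d)"
      by (auto simp: labelled_def ls)
    ultimately show ?thesis
      using b' unfolding eq by (intro half_full_less candidates_Nil[where ls = us])
  qed
qed

lemma first_fit_fresh:
  assumes none: "candidates NonSplittable n s d b (ls, A) = []" and w: "w \<notin> fst ` set ls"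
  shows "first_fit n es (opt NonSplittable n es)
    (ls @ [(w, tr_class s d, phase s d)], assign A t (w, sc_trail n s d) b)"
proof (rule first_fitI)
  fix us w' vs j s' d' b'
  assume ls: "ls @ [(w, tr_class s d, phase s d)] = us @ (w', tr_class s' d', phase s' d') # vs"
    and nz: "assign A t (w, sc_trail n s d) b j (w', sc_trail n s' d') \<noteq> 0"
    and j: "es ! j = Arrive s' d' b'" and b': "b' \<le> 1 / 2"
  show "card (labelled us (tr_class s' d') (phase s' d')) < 2 * opt NonSplittable n es"
  \<comment> \<open>If \<open>vs\<close> is empty, the entry in question is the new one, and none of
    its predecessors has space. Otherwise it is an old entry, whose predecessors and occupants are
    unchanged.\<close>
  proof (cases vs rule: rev_cases)
    case Nil
    with ls have eqs: "us = ls" "w' = w" by simp_all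
    have "A j (w, sc_trail n s' d') = 0" by (rule unlabelled_empty[OF C w])
    with nz have "j = t" by (auto simp: assign_apply eqs split: if_splits)
    with j arr have "s' = s" "d' = d" "b' = b" by simp_all
    with half_full_less[OF _ order_refl candidates_Nil[OF none]] b' eqs show ?thesis by simp
  next
    case (snoc vs' x)
    with ls have ls': "ls = us @ (w', tr_class s' d', phase s' d') # vs'" by simp
    then have "w' \<noteq> w" using w by auto
    with nz have "A j (w', sc_trail n s' d') \<noteq> 0" by (auto simp: assign_apply split: if_splits)
    from first_fitD[OF FF ls' this j b'] show ?thesis .
  qed
qed

end

lemma sc_step_first_fit:
  assumes n: "2 \<le> n" and R: "requests n es" and t: "t < length es"
    and C: "consistent NonSplittable n es (bw es t) st"
    and FF: "first_fit n es (opt NonSplittable n es) st"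
    and cnt: "\<And>i p. card (labelled (fst st) i p) \<le> 3 * opt NonSplittable n es"
    and step: "sc_step NonSplittable Allocation_Order n t (es ! t) st st'"
  shows "first_fit n es (opt NonSplittable n es) st' \<and>
    card (labelled (fst st') i p) \<le> 3 * opt NonSplittable n es"
proof -
  obtain ls A where st: "st = (ls, A)" by (cases st)
  show ?thesis
  proof (cases "es ! t")
    case (Arrive s d b)
    note ctx = n R t Arrive C[unfolded st] FF[unfolded st]
    have "sc_serve NonSplittable Allocation_Order n t s d b (ls, A) st'"
      using step by (simp add: Arrive st)
    from this requests_Arrive(3)[OF R t Arrive] show ?thesis
    proof (cases rule: sc_serve_NonSplittable)
      case found: (found w)
      with first_fit_found[OF ctx, of w] cnt[of i p] show ?thesis by (simp add: st)
    next
      case fresh: (fresh w)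
      with first_fit_fresh[OF ctx fresh(1,2)] cnt[of i p] first_fit_fresh_count[OF ctx fresh(1)]
      show ?thesis by (simp add: st card_labelled_snoc)
    qed
  next
    case (Depart j)
    define P where "P = (\<lambda>(w::nat, _::nat \<times> nat). w \<in> in_use (A(j := (\<lambda>_. 0))))"
    have st': "st' = (filter P ls, A(j := (\<lambda>_. 0)))"
      using step by (simp add: Depart st Let_def P_def)
    have "card (labelled (filter P ls) i p) \<le> card (labelled ls i p)"
      by (intro card_mono finite_labelled) (auto simp: labelled_def)
    with cnt[of i p] first_fit_depart[OF FF[unfolded st]] show ?thesis by (simp add: st' st)
  qed
qed

lemma sc_run_labelled_NonSplittable:
  assumes n: "2 \<le> n" and R: "requests n es" and t: "t \<le> length es"
    and S: "sc_run NonSplittable Allocation_Order n es S"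
  shows "card (labelled (fst (S t)) i p) \<le> 3 * opt NonSplittable n es"
proof -
  let ?k = "opt NonSplittable n es"
  have "first_fit n es ?k (S t) \<and> (\<forall>i p. card (labelled (fst (S t)) i p) \<le> 3 * ?k)"
    using t
  proof (induction t)
    case 0
    then show ?case using S by (simp add: sc_run_def labelled_def first_fit_def)
  next
    case (Suc t)
    then have t: "t < length es" by simp
    have step: "sc_step NonSplittable Allocation_Order n t (es ! t) (S t) (S (Suc t))"
      using S t by (simp add: sc_run_def)
    have C: "consistent NonSplittable n es (bw es t) (S t)"
      using t by (intro sc_run_consistent[OF R S]) simp
    from Suc t have "first_fit n es ?k (S t)" "\<And>i p. card (labelled (fst (S t)) i p) \<le> 3 * ?k"
      by simp_all
    from sc_step_first_fit[OF n R t C this step] show ?case by blast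
  qed
  then show ?thesis by blast
qed

section \<open>Counting labels\<close>

text \<open>Class \<open>i\<close> requires \<open>2 ^ (i - 1) < n\<close>, so \<open>i - 1\<close>
  is at most the logarithm. As classes start at 2, the offsets cancel and no additive constant
  remains.\<close>

lemma card_classes:
  assumes "2 \<le> n"
  defines "I \<equiv> {i. 2 \<le> i \<and> 2 ^ i < 2 * n}"
  shows "finite I" "real (card I) \<le> log 2 (real n)"
proof -
  have pos: "0 \<le> log 2 (real n)" using assms(1) by simp
  have sub: "I \<subseteq> {2..<nat \<lfloor>log 2 (real n)\<rfloor> + 2}"
  proof
    fix i assume "i \<in> I"
    then have i: "2 \<le> i" "2 ^ i < 2 * n" by (simp_all add: I_def)
    then obtain k where k: "i = Suc k" by (cases i) auto
    with i have "2 ^ k < n" by simp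
    then have "2 ^ k < real n" by (metis of_nat_less_iff of_nat_numeral of_nat_power)
    then have "real k \<le> log 2 (real n)"
      using assms(1) by (simp add: le_log_iff powr_realpow)
    then have "int k \<le> \<lfloor>log 2 (real n)\<rfloor>" by (simp add: le_floor_iff)
    with i k show "i \<in> {2..<nat \<lfloor>log 2 (real n)\<rfloor> + 2}" by simp
  qed
  then show "finite I" by (rule finite_subset) simp
  have "card I \<le> nat \<lfloor>log 2 (real n)\<rfloor>" using card_mono[OF _ sub] by simp
  then have "real (card I) \<le> real (nat \<lfloor>log 2 (real n)\<rfloor>)" by simp
  also have "\<dots> \<le> log 2 (real n)" using pos by linarith
  finally show "real (card I) \<le> log 2 (real n)" .
qed

lemma sc_uses_upper:
  assumes n: "2 \<le> n" and R: "requests n es" and v: "v = Splittable \<or> ord = Allocation_Order"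
    and k: "sc_uses v ord n es k"
  shows "real k \<le> 12 * log 2 (real n) * real (opt v n es)"
proof -
  obtain S where S: "sc_run v ord n es S" and kS: "k = wavelengths_used (\<lambda>t. snd (S t)) es"
    using k by (auto simp: sc_uses_def)
  \<comment> \<open>With splitting the bound is \<open>opt\<close> itself; it is relaxed to share
    the constant \<open>12 = 4 * 3\<close>, four phases times three.\<close>
  have labelled: "card (labelled (fst (S t)) i p) \<le> 3 * opt v n es" if "t \<le> length es" for t i p
  proof (cases v)
    case Splittable
    with sc_run_labelled_Splittable[OF n R that, of ord S i p] S show ?thesis by simp
  next
    case NonSplittable
    with sc_run_labelled_NonSplittable[OF n R that] S v show ?thesis by simp
  qed
  define I where "I = {i. 2 \<le> i \<and> 2 ^ i < 2 * n}"
  note I = card_classes[OF n, folded I_def]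
  have "card (in_use (snd (S t))) \<le> card I * (4 * (3 * opt v n es))" if t: "t \<le> length es" for t
  proof -
    obtain ls A where st: "S t = (ls, A)" by (cases "S t")
    have C: "consistent v n es (bw es t) (ls, A)" using sc_run_consistent[OF R S t] st by simp
    let ?U = "\<Union>i\<in>I. \<Union>p<4. labelled ls i p"
    have "in_use A \<subseteq> ?U"
    proof
      fix w assume "w \<in> in_use A"
      then obtain j u y where "A j (w, u, y) \<noteq> 0" by (auto simp: in_use_def)
      with consistentD(4,5)[OF C this] obtain s d b where j: "j < length es" "es ! j = Arrive s d b"
        and w: "w \<in> labelled ls (tr_class s d) (phase s d)" by blast
      note a = requests_Arrive[OF R j]
      have "2 ^ tr_class s d < 2 * n" using tr_class_bounds(1)[OF a(1)] a(2) by linarith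
      with a(5) have "tr_class s d \<in> I" by (simp add: I_def)
      moreover have "phase s d < 4" by (simp add: phase_def)
      ultimately show "w \<in> ?U" using w by blast
    qed
    then have "card (in_use A) \<le> card ?U" using I(1) by (intro card_mono) auto
    also have "\<dots> \<le> (\<Sum>i\<in>I. card (\<Union>p<4. labelled ls i p))" by (rule card_UN_le[OF I(1)])
    also have "\<dots> \<le> (\<Sum>i\<in>I. \<Sum>p<4. card (labelled ls i p))"
      by (intro sum_mono card_UN_le) simp
    also have "\<dots> \<le> (\<Sum>i\<in>I. \<Sum>p<(4::nat). 3 * opt v n es)"
      using labelled[OF t] st by (intro sum_mono) simp
    finally show ?thesis using st by simp
  qed
  then have "k \<le> card I * (4 * (3 * opt v n es))" unfolding kS by (rule wavelengths_used_le)
  then have "real k \<le> real (card I * (4 * (3 * opt v n es)))" by (simp only: of_nat_le_iff)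
  also have "\<dots> = 12 * real (card I) * real (opt v n es)" by simp
  also have "\<dots> \<le> 12 * log 2 (real n) * real (opt v n es)"
    using I(2) by (intro mult_right_mono mult_left_mono) simp_all
  finally show ?thesis .
qed

section \<open>Lower bound\<close>

text \<open>
  On this sequence, a single wavelength with one light-trail carries all transmissions, whereas
  SeparateClass puts transmissions of different classes on different wavelengths.
\<close>

definition class_sequence :: "nat \<Rightarrow> event list" where
  "class_sequence m = map (\<lambda>e. Arrive 0 (Suc (2 ^ Suc e)) (1 / real m)) [0..<m]"

lemma length_class_sequence [simp]: "length (class_sequence m) = m"
  by (simp add: class_sequence_def)

lemma nth_class_sequence [simp]:
  "e < m \<Longrightarrow> class_sequence m ! e = Arrive 0 (Suc (2 ^ Suc e)) (1 / real m)"
  by (simp add: class_sequence_def)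

text \<open>A length of one more than a power of 2 lies just inside the next class, so these
  transmissions have the pairwise different classes \<open>2, 3, ...\<close>.\<close>

lemma tr_class_power: "tr_class 0 (Suc (2 ^ Suc e)) = Suc (Suc e)"
  by (rule tr_class_eqI) simp_all

lemma requests_class_sequence:
  assumes "2 ^ m + 1 \<le> n - 1"
  shows "requests n (class_sequence m)"
proof -
  have "Suc (2 ^ Suc e) \<le> n - 1" if "e < m" for e
  proof -
    have "(2::nat) ^ Suc e \<le> 2 ^ m" using that by (intro power_increasing) auto
    with assms show ?thesis by linarith
  qed
  then show ?thesis by (simp add: requests_def tr_class_power del: power_Suc)
qed

lemma bw_class_sequence:
  assumes "t \<le> m"
  shows "bw (class_sequence m) t j = (if j < t then 1 / real m else 0)"
proof -
  have "Depart j \<notin> set (take t (class_sequence m))"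
    by (rule contra_subsetD[OF set_take_subset]) (auto simp: class_sequence_def)
  with assms show ?thesis by (simp add: bw_def)
qed

lemma opt_class_sequence:
  assumes n: "2 \<le> n" and m: "0 < m" "2 ^ m + 1 \<le> n - 1"
  shows "opt v n (class_sequence m) = 1"
proof -
  let ?es = "class_sequence m"
  note R = requests_class_sequence[OF m(2)]
  define A where "A = (\<lambda>t j. (\<lambda>_. 0)((0::nat, 0::nat, n - 1) := bw ?es t j))"
  have "(\<Sum>j | j < t \<and> 0 = w. bw ?es t j) \<le> 1" if "t \<le> length ?es" for t and w :: nat
  proof (cases "w = 0")
    case True
    then have "(\<Sum>j | j < t \<and> 0 = w. bw ?es t j) = (\<Sum>j<t. 1 / real m)"
      using that by (intro sum.cong) (auto simp: bw_class_sequence)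
    \<comment> \<open>The bandwidth \<open>1 / real m\<close> is chosen so that all \<open>m\<close>
      transmissions just fit on one light-trail.\<close>
    also have "\<dots> \<le> 1" using that m(1) by (simp add: field_simps)
    finally show ?thesis .
  qed simp
  from schedule_exists[where \<sigma> = "\<lambda>_. 0" and v = v, OF n R this]
  have S: "schedule v n ?es (\<lambda>_ _. {0, n - 1}) A" by (simp add: A_def)
  have "wavelengths_used A ?es \<le> 1"
  proof (rule wavelengths_used_le)
    fix t
    have "in_use (A t) \<subseteq> {0}" by (auto simp: in_use_def A_def split: if_splits)
    then have "card (in_use (A t)) \<le> card {0::nat}" by (intro card_mono) simp_all
    then show "card (in_use (A t)) \<le> 1" by simp
  qed
  moreover have "opt v n ?es \<le> wavelengths_used A ?es"
    unfolding opt_def using S by (intro Least_le) blast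
  moreover have "0 < opt v n ?es"
  proof -
    have "{0} \<subseteq> link_users ?es 0" using m(1) by (simp add: link_users_def)
    from congestion_le_opt[OF n R _ this, of m v] m(1)
    have "1 / real m \<le> real (opt v n ?es)" by (simp add: bw_class_sequence)
    moreover have "0 < 1 / real m" using m(1) by simp
    ultimately have "0 < real (opt v n ?es)" by linarith
    then show ?thesis by simp
  qed
  ultimately show ?thesis by linarith
qed

text \<open>Nothing departs, so at the end every transmission occupies a wavelength labelled with
  its own class. A wavelength has only one label, so there are at least \<open>m\<close> of them,
  for either variation and any search.\<close>

lemma sc_uses_class_sequence:
  assumes m: "2 ^ m + 1 \<le> n - 1" and k: "sc_uses v ord n (class_sequence m) k"
  shows "m \<le> k"
proof -
  let ?es = "class_sequence m"
  note R = requests_class_sequence[OF m]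
  obtain S where S: "sc_run v ord n ?es S" and kS: "k = wavelengths_used (\<lambda>t. snd (S t)) ?es"
    using k by (auto simp: sc_uses_def)
  obtain ls A where st: "S m = (ls, A)" by (cases "S m")
  have C: "consistent v n ?es (bw ?es m) (ls, A)" using sc_run_consistent[OF R S, of m] st by simp
  have "\<exists>w. w \<in> in_use A \<and> (\<exists>p. w \<in> labelled ls (Suc (Suc e)) p)" if e: "e < m" for e
  proof -
    have "0 < bw ?es m e" using e by (simp add: bw_class_sequence)
    then obtain L where L: "A e L \<noteq> 0" using division_pos[OF consistentD(2)[OF C]] by blast
    from consistentD(5)[OF C L] e obtain w where "L = (w, sc_trail n 0 (Suc (2 ^ Suc e)))"
      "w \<in> labelled ls (Suc (Suc e)) (phase 0 (Suc (2 ^ Suc e)))"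
      by (auto simp: tr_class_power simp del: power_Suc)
    with L show ?thesis
      by (cases "sc_trail n 0 (Suc (2 ^ Suc e))") (auto simp: in_use_def simp del: power_Suc)
  qed
  then obtain w p where w: "\<And>e. e < m \<Longrightarrow> w e \<in> in_use A"
    "\<And>e. e < m \<Longrightarrow> w e \<in> labelled ls (Suc (Suc e)) (p e)" by metis
  have "inj_on w {..<m}"
  proof (rule inj_onI)
    fix e e' assume e: "e \<in> {..<m}" "e' \<in> {..<m}" "w e = w e'"
    have "w e \<in> labelled ls (Suc (Suc e)) (p e)" "w e \<in> labelled ls (Suc (Suc e')) (p e')"
      using w(2)[of e] w(2)[of e'] e(1,2) unfolding e(3) by blast+
    from label_unique(1)[OF consistentD(1)[OF C] this] show "e = e'" by simp
  qed
  then have "m = card (w ` {..<m})" by (simp add: card_image)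
  also have "\<dots> \<le> card (in_use A)"
  proof (rule card_mono)
    show "finite (in_use A)"
      using consistentD(4)[OF C] divisionD(1)[OF consistentD(2)[OF C]] by (rule finite_in_use)
  qed (use w(1) in auto)
  also have "\<dots> \<le> k"
    using card_le_wavelengths_used[of m ?es "\<lambda>t. snd (S t)"] by (simp add: kS st)
  finally show ?thesis .
qed

text \<open>\<open>m\<close> is the integer part of the logarithm of \<open>n - 2\<close>, so that
  the longest transmission, which ends at node \<open>2 ^ m + 1\<close>, fits into the array. From
  \<open>4 \<le> n\<close> it follows that \<open>m\<close> is positive.\<close>

lemma log_bracket:
  fixes n :: nat
  assumes "4 \<le> n"
  obtains m where "0 < m" "2 ^ m + 1 \<le> n - 1" "log 2 (real n) \<le> 3 * real m"
proof -
  obtain m where m: "2 ^ m \<le> n - 2" "n - 2 < 2 ^ Suc m"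
    using ex_power_ivl1[of 2 "n - 2"] assms by fastforce
  have m0: "0 < m"
  proof (rule ccontr)
    assume "\<not> 0 < m"
    with m(2) assms show False by simp
  qed
  have "n \<le> 2 ^ Suc m + 1" using m(2) by linarith
  also have "\<dots> \<le> 2 ^ (m + 2)" by simp
  \<comment> \<open>\<open>m + 2 \<le> 3 * m\<close> since \<open>m\<close> is positive; this is the
    origin of the constant 1/3 in the lower bound.\<close>
  also have "\<dots> \<le> 2 ^ (3 * m)" using m0 by (intro power_increasing) auto
  finally have "real n \<le> 2 ^ (3 * m)" by (metis of_nat_le_iff of_nat_numeral of_nat_power)
  then have "log 2 (real n) \<le> log 2 (2 ^ (3 * m))" using assms by (intro log_mono) auto
  then have "log 2 (real n) \<le> 3 * real m" by (simp add: log_nat_power)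
  moreover have "2 ^ m + 1 \<le> n - 1" using m(1) assms by linarith
  ultimately show ?thesis using that m0 by blast
qed

theorem theorem6:
  "(\<forall>v ord. v = Splittable \<or> ord = Allocation_Order \<longrightarrow>
      (\<exists>C>0. \<forall>n\<ge>2. \<forall>es. requests n es \<longrightarrow>
         (\<exists>k. sc_uses v ord n es k) \<and>
         (\<forall>k. sc_uses v ord n es k \<longrightarrow>
            real k \<le> C * log 2 (real n) * real (opt v n es)))) \<and>
   (\<forall>v ord. \<exists>c>0. \<forall>n\<ge>4. \<exists>es. requests n es \<and> 0 < opt v n es \<and>
      (\<exists>k. sc_uses v ord n es k) \<and>
      (\<forall>k. sc_uses v ord n es k \<longrightarrow>
         c * log 2 (real n) * real (opt v n es) \<le> real k))"
proof -
  have ex: "\<exists>k. sc_uses v ord n es k" if "requests n es" for v ord n es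
    using sc_run_exists[OF that] unfolding sc_uses_def by blast
  show ?thesis
  proof (intro conjI allI impI, goal_cases)
    case (1 v ord)
    then show ?case using ex sc_uses_upper by (intro exI[of _ 12]) simp
  next
    case (2 v ord)
    have "\<exists>es. requests n es \<and> 0 < opt v n es \<and> (\<exists>k. sc_uses v ord n es k) \<and>
      (\<forall>k. sc_uses v ord n es k \<longrightarrow> 1 / 3 * log 2 (real n) * real (opt v n es) \<le> real k)"
      if n: "4 \<le> n" for n
    proof -
      obtain m where m: "0 < m" "2 ^ m + 1 \<le> n - 1" "log 2 (real n) \<le> 3 * real m"
        by (rule log_bracket[OF n])
      have opt: "opt v n (class_sequence m) = 1"
        using n by (intro opt_class_sequence m) simp
      have "1 / 3 * log 2 (real n) * real (opt v n (class_sequence m)) \<le> real k"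
        if "sc_uses v ord n (class_sequence m) k" for k
        using sc_uses_class_sequence[OF m(2) that] m(3) by (simp add: opt)
      with requests_class_sequence[OF m(2)] ex opt show ?thesis
        by (intro exI[of _ "class_sequence m"]) simp
    qed
    then show ?case by (intro exI[of _ "1 / 3"]) simp
  qed
qed

end
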